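(* Let $k\geq 1$ and let $n\geq 2k+1$ be an integer. Then $\dim_{\mathbb{C}} QP_k(n)$ is equal to the number of set partitions of a set of $2k$ elements without blocks of size one. This number is given by $$\sum_{j=1}^{2k}(-1)^{j-1}B(2k-j)+1,$$ where $B(r)$ is the $r$-th Bell number.
   Context: The quasi-partition algebra is $QP_k(n)=\mathrm{End}_{S_n}(W^{\otimes k})$, where $W=S^{(n-1,1)}$ is the $(n-1)$-dimensional irreducible complex representation of $S_n$ indexed by the partition $(n-1,1)$ and $S_n$ acts diagonally on $W^{\otimes k}$. The Bell number $B(r)$ is the number of set partitions of a set with $r$ elements, with $B(0)=1$. *)

theory Defs
  imports Complex_Main "HOL-Library.Function_Algebras" "HOL-Library.Disjoint_Sets"
    "HOL-Combinatorics.Permutations"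
begin

section \<open>Complex vector spaces of functions\<close>

definition cscale :: "complex \<Rightarrow> ('x \<Rightarrow> complex) \<Rightarrow> 'x \<Rightarrow> complex"
  where "cscale c f = (\<lambda>x. c * f x)"

definition map_scale :: "complex \<Rightarrow> ('y \<Rightarrow> 'x \<Rightarrow> complex) \<Rightarrow> 'y \<Rightarrow> 'x \<Rightarrow> complex"
  where "map_scale c F = (\<lambda>y. cscale c (F y))"

global_interpretation cfun: vector_space cscale
  by unfold_locales (auto simp: cscale_def fun_eq_iff algebra_simps)

global_interpretation cmap: vector_space map_scale
  by unfold_locales (auto simp: map_scale_def cscale_def fun_eq_iff algebra_simps)


section \<open>Specht modules\<close>

text \<open>A partition is given as the list \<open>la\<close> of its parts, with \<open>n = sum_list la\<close>, and the symmetric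
  group \<open>S\<^sub>n\<close> is the set of all \<open>p\<close> with \<open>p permutes {..<n}\<close>. Rows and columns are numbered from 0.\<close>

definition cells :: "nat list \<Rightarrow> (nat \<times> nat) set"
  where "cells la = {(i, j). i < length la \<and> j < la ! i}"

definition tableaux :: "nat list \<Rightarrow> (nat \<times> nat \<Rightarrow> nat) set"
  where "tableaux la = {t. bij_betw t (cells la) {..<sum_list la}}"

definition row :: "nat list \<Rightarrow> (nat \<times> nat \<Rightarrow> nat) \<Rightarrow> nat \<Rightarrow> nat set"
  where "row la t i = t ` {(a, b) \<in> cells la. a = i}"

definition col :: "nat list \<Rightarrow> (nat \<times> nat \<Rightarrow> nat) \<Rightarrow> nat \<Rightarrow> nat set"
  where "col la t j = t ` {(a, b) \<in> cells la. b = j}"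

text \<open>The tabloid of a tableau, i.e. its class modulo permutations within the rows, is recorded as the
  list of the sets of entries of its rows.\<close>

type_synonym tabloid = "nat set list"

definition tabloid_of :: "nat list \<Rightarrow> (nat \<times> nat \<Rightarrow> nat) \<Rightarrow> tabloid"
  where "tabloid_of la t = map (row la t) [0..<length la]"

definition col_stabilizer :: "nat list \<Rightarrow> (nat \<times> nat \<Rightarrow> nat) \<Rightarrow> (nat \<Rightarrow> nat) set"
  where "col_stabilizer la t =
    {p. p permutes {..<sum_list la} \<and> (\<forall>j. p ` col la t j = col la t j)}"

definition polytabloid :: "nat list \<Rightarrow> (nat \<times> nat \<Rightarrow> nat) \<Rightarrow> tabloid \<Rightarrow> complex"
  where "polytabloid la t =
    (\<lambda>T. \<Sum>p\<in>col_stabilizer la t. of_int (sign p) * of_bool (T = tabloid_of la (p \<circ> t)))"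

definition specht :: "nat list \<Rightarrow> (tabloid \<Rightarrow> complex) set"
  where "specht la = cfun.span (polytabloid la ` tableaux la)"

definition tabloid_act :: "(nat \<Rightarrow> nat) \<Rightarrow> tabloid \<Rightarrow> tabloid"
  where "tabloid_act p T = map ((`) p) T"

text \<open>The inverse makes the basis vector of a tabloid \<open>T\<close> go to that of \<open>tabloid_act p T\<close>.\<close>

definition specht_act :: "(nat \<Rightarrow> nat) \<Rightarrow> (tabloid \<Rightarrow> complex) \<Rightarrow> tabloid \<Rightarrow> complex"
  where "specht_act p f = (\<lambda>T. f (tabloid_act (inv p) T))"


section \<open>Tensor powers\<close>

text \<open>For a space \<open>W\<close> of functions on \<open>X\<close>, the canonical map from the \<open>k\<close>-th tensor power of \<open>W\<close> to the
  functions on \<open>X\<^sup>k\<close> is injective, and the tensor power is identified with its image, the span of the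
  decomposable tensors. Elements of \<open>X\<^sup>k\<close> are lists of length \<open>k\<close>; tensors vanish on all other lists.\<close>

definition pure_tensor :: "('x \<Rightarrow> complex) list \<Rightarrow> 'x list \<Rightarrow> complex"
  where "pure_tensor ws xs =
    (if length xs = length ws then \<Prod>i<length ws. (ws ! i) (xs ! i) else 0)"

definition tensor_power :: "nat \<Rightarrow> ('x \<Rightarrow> complex) set \<Rightarrow> ('x list \<Rightarrow> complex) set"
  where "tensor_power k W = cfun.span {pure_tensor ws |ws. length ws = k \<and> set ws \<subseteq> W}"

definition diag_act :: "(nat \<Rightarrow> nat) \<Rightarrow> (tabloid list \<Rightarrow> complex) \<Rightarrow> tabloid list \<Rightarrow> complex"
  where "diag_act p u = (\<lambda>Ts. u (map (tabloid_act (inv p)) Ts))"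

lemma diag_act_pure_tensor:
  "diag_act p (pure_tensor ws) = pure_tensor (map (specht_act p) ws)"
  by (auto simp: diag_act_def pure_tensor_def specht_act_def fun_eq_iff)


section \<open>The quasi-partition algebra\<close>

text \<open>Linear endomorphisms of a subspace \<open>U\<close> are represented by functions on the whole type that are 0
  outside \<open>U\<close>, so that every endomorphism is represented exactly once.\<close>

definition endomorphisms :: "('x \<Rightarrow> complex) set \<Rightarrow> (('x \<Rightarrow> complex) \<Rightarrow> 'x \<Rightarrow> complex) set"
  where "endomorphisms U = {F.
    (\<forall>u\<in>U. F u \<in> U) \<and>
    (\<forall>u\<in>U. \<forall>v\<in>U. F (u + v) = F u + F v) \<and>
    (\<forall>c. \<forall>u\<in>U. F (cscale c u) = cscale c (F u)) \<and>
    (\<forall>u. u \<notin> U \<longrightarrow> F u = 0)}"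

definition quasi_partition_algebra ::
    "nat \<Rightarrow> nat \<Rightarrow> ((tabloid list \<Rightarrow> complex) \<Rightarrow> tabloid list \<Rightarrow> complex) set"
  where "quasi_partition_algebra k n =
    (let U = tensor_power k (specht [n - 1, 1])
     in {F \<in> endomorphisms U. \<forall>p. p permutes {..<n} \<longrightarrow> (\<forall>u\<in>U. F (diag_act p u) = diag_act p (F u))})"


section \<open>Bell numbers\<close>

definition bell :: "nat \<Rightarrow> nat"
  where "bell r = card {P. partition_on {..<r} P}"

end

theory Submission
  imports Defs
begin

text \<open>
  The Specht module \<open>W\<close> of shape \<open>[n - 1, 1]\<close> consists of the functions with sum zero on the \<open>n\<close> tabloids
  of this shape (\<open>specht_hook\<close>), on which the symmetric group acts by all permutations. An endomorphism
  of the tensor power is therefore given by a matrix indexed by pairs of words of length \<open>k\<close>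
  over an alphabet \<open>X\<close> of \<open>n\<close> letters, that is, by a function on words of length \<open>2 k\<close>. In terms of
  matrices, the endomorphisms form the tensor power of \<open>W\<close> with \<open>2 k\<close> factors, which is the image of a
  projection \<open>P\<close> of all functions on words (\<open>endo_matrix_matrix_endo\<close>, \<open>matrix_endo_endo_matrix\<close>).

  Equivariance means that the matrix is constant on orbits of words, and two words lie in the same
  orbit if and only if the same positions carry equal letters. Let \<open>d R\<close> be the indicator function of
  the words that are constant on the blocks of the set partition \<open>R\<close> of the \<open>2 k\<close> positions. The \<open>d R\<close>
  span the invariant functions by Moebius inversion (\<open>kernel_function_in_span\<close>), and they are linearly
  independent when there are at least \<open>2 k\<close> letters (\<open>diagram_coefficients_zero\<close>).

  If \<open>R\<close> has a block of size one then \<open>P (d R) = 0\<close>, since \<open>d R\<close> does not depend on the letter at that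
  position. In general \<open>P (d R)\<close> differs from \<open>d R\<close> by a combination of functions \<open>d S\<close> for partitions
  \<open>S\<close> with a block of size one (\<open>project_modulo_singular\<close>), because subtracting the average over one letter
  isolates that position. Hence the \<open>P (d R)\<close> for singleton-free \<open>R\<close> are a basis of the equivariant
  endomorphisms (\<open>dim_commutant\<close>).

  For the count, let \<open>a(m)\<close> be the number of singleton-free partitions of \<open>m\<close> points. Merging all
  singletons with one new point is a bijection from the partitions of \<open>m\<close> points that have a singleton to
  the singleton-free partitions of \<open>m + 1\<close> points. Thus \<open>B(m) = a(m) + a(m + 1)\<close>
  (\<open>card_partitions_split\<close>), and the alternating sum follows by induction.
\<close>

section \<open>Linear algebra of function spaces\<close>

lemma sum_fun_apply: "(\<Sum>i\<in>I. f i) x = (\<Sum>i\<in>I. f i x)"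
  by (induction I rule: infinite_finite_induct) auto

lemma cscale_apply: "cscale c f x = c * f x"
  by (simp add: cscale_def)

lemma map_scale_apply: "map_scale c F u = cscale c (F u)"
  by (simp add: map_scale_def)

lemma (in vector_space) span_image_eq_sums:
  assumes "finite I" "v \<in> span (f ` I)"
  obtains c where "v = (\<Sum>i\<in>I. c i *s f i)"
proof -
  let ?S = "{\<Sum>i\<in>I. c i *s f i |c. True}"
  have "span (f ` I) \<subseteq> ?S"
  proof (rule span_minimal)
    show "f ` I \<subseteq> ?S"
    proof
      fix w assume "w \<in> f ` I"
      then obtain i where "i \<in> I" "w = f i" by auto
      then have "w = (\<Sum>j\<in>I. (if j = i then 1 else 0) *s f j)"
        using assms(1) by (simp add: if_distrib[of "\<lambda>x. x *s _"] cong: if_cong)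
      then show "w \<in> ?S" by (auto intro!: exI[of _ "\<lambda>j. if j = i then 1 else 0"])
    qed
    show "subspace ?S"
      unfolding subspace_def
    proof (intro conjI ballI allI)
      show "0 \<in> ?S" by (auto intro!: exI[of _ "\<lambda>_. 0"])
      fix v w a assume v: "v \<in> ?S"
      then obtain c where c: "v = (\<Sum>i\<in>I. c i *s f i)" by auto
      have "a *s v = (\<Sum>i\<in>I. (a * c i) *s f i)"
        unfolding c scale_sum_right by simp
      then show "a *s v \<in> ?S" by (auto intro!: exI[of _ "\<lambda>i. a * c i"])
      assume "w \<in> ?S"
      then obtain d where d: "w = (\<Sum>i\<in>I. d i *s f i)" by auto
      have "v + w = (\<Sum>i\<in>I. (c i + d i) *s f i)"
        unfolding c d by (simp add: scale_left_distrib sum.distrib)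
      then show "v + w \<in> ?S" by (auto intro!: exI[of _ "\<lambda>i. c i + d i"])
    qed
  qed
  then show thesis using assms(2) that by auto
qed

text \<open>Linear independence is required of the family, so that it also shows that the family has no
  repetitions.\<close>

lemma (in vector_space) dim_eq_card_family:
  assumes "finite I" "f ` I \<subseteq> V" "V \<subseteq> span (f ` I)"
    and ind: "\<And>c i. (\<Sum>i\<in>I. c i *s f i) = 0 \<Longrightarrow> i \<in> I \<Longrightarrow> c i = 0"
  shows "dim V = card I"
proof -
  have inj: "inj_on f I"
  proof (rule inj_onI, rule ccontr)
    fix i j assume ij: "i \<in> I" "j \<in> I" "f i = f j" "i \<noteq> j"
    let ?c = "\<lambda>l. (if l = i then 1 else 0) - (if l = j then 1 else 0)"
    have "(\<Sum>l\<in>I. ?c l *s f l)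
      = (\<Sum>l\<in>I. (if l = i then 1 else 0) *s f l) - (\<Sum>l\<in>I. (if l = j then 1 else 0) *s f l)"
      by (simp only: scale_left_diff_distrib sum_subtractf)
    also have "\<dots> = 0"
      using ij assms(1) by (simp add: if_distrib[of "\<lambda>x. x *s _"] cong: if_cong)
    finally show False using ind[of ?c i] ij by auto
  qed
  have "independent (f ` I)"
  proof (rule independent_if_scalars_zero)
    fix c v assume "(\<Sum>v\<in>f ` I. c v *s v) = 0" "v \<in> f ` I"
    then show "c v = 0" using ind[of "\<lambda>i. c (f i)"] inj by (auto simp: sum.reindex)
  qed (use assms in simp)
  then show ?thesis
    using dim_unique[OF assms(2,3)] card_image[OF inj] by simp
qed


section \<open>Words and the projection onto the tensor power\<close>

definition words :: "'x set \<Rightarrow> nat \<Rightarrow> 'x list set"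
  where "words X L = {xs. set xs \<subseteq> X \<and> length xs = L}"

definition zero_sum :: "'x set \<Rightarrow> ('x \<Rightarrow> complex) set"
  where "zero_sum X = {w. (\<forall>x. x \<notin> X \<longrightarrow> w x = 0) \<and> sum w X = 0}"

text \<open>The projection of the basis vector of \<open>a\<close> onto the functions with sum zero.\<close>

definition centred :: "'x set \<Rightarrow> 'x \<Rightarrow> 'x \<Rightarrow> complex"
  where "centred X a = (\<lambda>b. if b \<in> X then of_bool (a = b) - 1 / of_nat (card X) else 0)"

definition centred_tensor :: "'x set \<Rightarrow> 'x list \<Rightarrow> 'x list \<Rightarrow> complex"
  where "centred_tensor X ys = pure_tensor (map (centred X) ys)"

text \<open>The orthogonal projection of the functions on words onto the tensor power of \<open>zero_sum X\<close>, as the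
  matrix with columns \<open>centred_tensor X y\<close>.\<close>

definition project :: "'x set \<Rightarrow> nat \<Rightarrow> ('x list \<Rightarrow> complex) \<Rightarrow> 'x list \<Rightarrow> complex"
  where "project X L f = (\<Sum>y\<in>words X L. cscale (f y) (centred_tensor X y))"

lemma centred_tensor_eq:
  "centred_tensor X ys xs
    = (if length xs = length ys then \<Prod>i<length ys. centred X (ys ! i) (xs ! i) else 0)"
  by (simp add: centred_tensor_def pure_tensor_def)

lemma centred_tensor_eq_words:
  assumes "xs \<in> words X L" "ys \<in> words X L"
  shows "centred_tensor X ys xs = (\<Prod>i<L. of_bool (ys ! i = xs ! i) - 1 / of_nat (card X))"
proof -
  have "centred_tensor X ys xs = (\<Prod>i<L. centred X (ys ! i) (xs ! i))"
    using assms by (simp add: centred_tensor_eq words_def)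
  also have "\<dots> = (\<Prod>i<L. of_bool (ys ! i = xs ! i) - 1 / of_nat (card X))"
  proof (rule prod.cong)
    fix i assume "i \<in> {..<L}"
    then have "xs ! i \<in> X" using assms(1) by (auto simp: words_def subset_iff)
    then show "centred X (ys ! i) (xs ! i) = of_bool (ys ! i = xs ! i) - 1 / of_nat (card X)"
      by (simp add: centred_def)
  qed simp
  finally show ?thesis .
qed

lemma centred_tensor_symmetric:
  assumes "xs \<in> words X L" "ys \<in> words X L"
  shows "centred_tensor X ys xs = centred_tensor X xs ys"
  unfolding centred_tensor_eq_words[OF assms] centred_tensor_eq_words[OF assms(2,1)]
  by (simp add: eq_commute)

lemma centred_tensor_outside:
  assumes "ys \<in> words X L" "xs \<notin> words X L"
  shows "centred_tensor X ys xs = 0"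
proof (cases "length xs = L")
  case True
  then have "\<exists>i<L. xs ! i \<notin> X" using assms(2) by (auto simp: words_def in_set_conv_nth)
  then have "\<exists>i<L. centred X (ys ! i) (xs ! i) = 0" by (auto simp: centred_def)
  then show ?thesis using assms(1) True by (auto simp: centred_tensor_eq words_def intro!: prod_zero)
next
  case False
  then show ?thesis using assms(1) by (simp add: centred_tensor_eq words_def)
qed

text \<open>Tensors in \<open>k + l\<close> factors are products, which allows a matrix indexed by pairs of words of length
  \<open>k\<close> to be treated as a function on words of length \<open>2 * k\<close>.\<close>

lemma centred_tensor_append:
  assumes "length x = length y" 
  shows "centred_tensor X (y @ y') (x @ x') = centred_tensor X y x * centred_tensor X y' x'"
proof (cases "length x' = length y'")
  case True
  let ?f = "\<lambda>i. centred X ((y @ y') ! i) ((x @ x') ! i)"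
  have "prod ?f {..<length y + length y'} = prod ?f {..<length y} * prod ?f {length y..<length y + length y'}"
    by (rule prod.atLeastLessThan_concat[of 0, simplified atLeast0LessThan, symmetric]) auto
  also have "prod ?f {length y..<length y + length y'} = (\<Prod>i<length y'. centred X (y' ! i) (x' ! i))"
    using prod.shift_bounds_nat_ivl[of ?f 0 "length y" "length y'"] assms
    by (simp add: atLeast0LessThan nth_append add.commute)
  also have "prod ?f {..<length y} = (\<Prod>i<length y. centred X (y ! i) (x ! i))"
    using assms by (intro prod.cong) (auto simp: nth_append)
  finally show ?thesis using True assms by (simp add: centred_tensor_eq)
next
  case False
  then show ?thesis using assms by (simp add: centred_tensor_eq)
qed

lemma project_apply: "project X L f x = (\<Sum>y\<in>words X L. f y * centred_tensor X y x)"
  by (simp add: project_def sum_fun_apply cscale_apply)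

lemma project_outside: "x \<notin> words X L \<Longrightarrow> project X L f x = 0"
  by (simp add: project_apply centred_tensor_outside)

lemma project_cong: "(\<And>x. x \<in> words X L \<Longrightarrow> f x = g x) \<Longrightarrow> project X L f = project X L g"
  by (simp add: project_def)

lemma project_add: "project X L (f + g) = project X L f + project X L g"
  by (simp add: project_def cfun.scale_left_distrib sum.distrib)

lemma project_scale: "project X L (cscale c f) = cscale c (project X L f)"
  by (simp add: project_def cfun.scale_sum_right cscale_apply)

lemma words_list_update: "xs \<in> words X L \<Longrightarrow> a \<in> X \<Longrightarrow> xs[i := a] \<in> words X L"
  using set_update_subset_insert[of xs i a] by (auto simp: words_def)

lemma words_append:
  assumes "x \<in> words X k" "y \<in> words X l"
  shows "x @ y \<in> words X (k + l)"
  using assms by (auto simp: words_def)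

lemma sum_words_append:
  "(\<Sum>z\<in>words X (k + l). f z) = (\<Sum>x\<in>words X k. \<Sum>y\<in>words X l. f (x @ y))"
proof -
  have "(\<Sum>z\<in>words X (k + l). f z) = (\<Sum>(x, y)\<in>words X k \<times> words X l. f (x @ y))"
    by (rule sum.reindex_bij_witness[where i = "\<lambda>(x, y). x @ y" and j = "\<lambda>z. (take k z, drop k z)"])
      (auto simp: words_def dest: in_set_takeD in_set_dropD)
  then show ?thesis by (simp add: sum.cartesian_product)
qed

locale alphabet =
  fixes X :: "'x set"
  assumes finite_alphabet: "finite X" and alphabet_nonempty: "X \<noteq> {}"
begin

lemma finite_words [simp]: "finite (words X L)"
  unfolding words_def by (rule finite_lists_length_eq[OF finite_alphabet])

lemma card_alphabet [simp]: "card X \<noteq> 0"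
  using finite_alphabet alphabet_nonempty by simp

lemma sum_prod_words:
  fixes f :: "nat \<Rightarrow> 'x \<Rightarrow> complex"
  shows "(\<Sum>xs\<in>words X L. \<Prod>i<L. f i (xs ! i)) = (\<Prod>i<L. \<Sum>a\<in>X. f i a)"
proof (induction L arbitrary: f)
  case 0
  have "words X 0 = {[]}" by (auto simp: words_def)
  then show ?case by simp
next
  case (Suc L)
  have "(\<Sum>xs\<in>words X (Suc L). \<Prod>i<Suc L. f i (xs ! i))
      = (\<Sum>(a, xs)\<in>X \<times> words X L. f 0 a * (\<Prod>i<L. f (Suc i) (xs ! i)))"
    by (rule sum.reindex_bij_witness[where i = "\<lambda>(a, xs). a # xs" and j = "\<lambda>xs. (hd xs, tl xs)"])
      (auto simp: words_def length_Suc_conv prod.lessThan_Suc_shift simp del: prod.lessThan_Suc)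
  also have "\<dots> = (\<Sum>a\<in>X. f 0 a) * (\<Prod>i<L. \<Sum>a\<in>X. f (Suc i) a)"
    by (simp add: sum.cartesian_product[symmetric] sum_product Suc.IH[of "\<lambda>i. f (Suc i)", symmetric])
  finally show ?case by (simp add: prod.lessThan_Suc_shift del: prod.lessThan_Suc)
qed

lemma centred_zero_sum: "a \<in> X \<Longrightarrow> centred X a \<in> zero_sum X"
  using finite_alphabet
  by (auto simp: zero_sum_def centred_def sum_subtractf of_bool_def)

lemma sum_centred: "b \<in> X \<Longrightarrow> (\<Sum>a\<in>X. centred X a b) = 0"
  using finite_alphabet alphabet_nonempty by (simp add: centred_def sum_subtractf of_bool_def)

lemma zero_sum_expand:
  assumes "w \<in> zero_sum X"
  shows "(\<Sum>a\<in>X. w a * centred X a b) = w b"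
proof (cases "b \<in> X")
  case True
  have "(\<Sum>a\<in>X. w a * centred X a b) = (\<Sum>a\<in>X. w a * of_bool (a = b)) - sum w X / of_nat (card X)"
    using True by (simp add: centred_def right_diff_distrib sum_subtractf sum_divide_distrib)
  then show ?thesis using assms True finite_alphabet by (simp add: zero_sum_def of_bool_def if_distrib cong: if_cong)
next
  case False
  then show ?thesis using assms by (simp add: centred_def zero_sum_def)
qed

lemma centred_tensor_in_tensor_power:
  assumes "y \<in> words X k"
  shows "centred_tensor X y \<in> tensor_power k (zero_sum X)"
  unfolding tensor_power_def centred_tensor_def
  using assms
  by (intro cfun.span_base) (auto simp: words_def centred_zero_sum subset_iff intro!: exI[of _ "map (centred X) y"])

lemma subspace_tensor_power: "cfun.subspace (tensor_power k W)"
  unfolding tensor_power_def by (rule cfun.subspace_span)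

lemma project_in_tensor_power: "project X k u \<in> tensor_power k (zero_sum X)"
  unfolding project_def
  by (intro cfun.subspace_sum[OF subspace_tensor_power] cfun.subspace_scale[OF subspace_tensor_power]
      centred_tensor_in_tensor_power)

text \<open>On a pure tensor the sum over all words factors into sums over single letters, and
  \<open>\<Sum>a. w a * centred X a b = w b\<close> holds for every \<open>w\<close> with sum zero.\<close>

lemma project_tensor_power:
  assumes "u \<in> tensor_power k (zero_sum X)"
  shows "project X k u = u"
  using assms unfolding tensor_power_def
proof (induction rule: cfun.span_induct)
  case base
  show ?case
    by (auto simp: cfun.subspace_def project_add project_scale)
      (simp add: project_def)
next
  case (step u)
  then obtain ws where u: "u = pure_tensor ws" and ws: "length ws = k" "set ws \<subseteq> zero_sum X" by auto
  have "project X k u x = u x" for x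
  proof (cases "length x = k")
    case True
    have "project X k u x = (\<Sum>y\<in>words X k. \<Prod>i<k. (ws ! i) (y ! i) * centred X (y ! i) (x ! i))"
      unfolding project_apply u using ws True
      by (intro sum.cong) (auto simp: words_def pure_tensor_def centred_tensor_eq prod.distrib)
    also have "\<dots> = (\<Prod>i<k. \<Sum>a\<in>X. (ws ! i) a * centred X a (x ! i))"
      by (rule sum_prod_words)
    also have "\<dots> = (\<Prod>i<k. (ws ! i) (x ! i))"
      using ws by (intro prod.cong zero_sum_expand) (auto simp: subset_iff)
    also have "\<dots> = u x" using ws True by (simp add: u pure_tensor_def)
    finally show ?thesis .
  next
    case False
    then have "x \<notin> words X k" by (simp add: words_def)
    then show ?thesis using False ws by (simp add: project_outside u pure_tensor_def)
  qed
  then show ?case by auto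
qed

lemma sum_words_update:
  fixes h :: "'x list \<Rightarrow> complex"
  assumes "i < L"
  shows "(\<Sum>y\<in>words X L. \<Sum>a\<in>X. h (y[i := a])) = of_nat (card X) * (\<Sum>y\<in>words X L. h y)"
proof -
  \<comment> \<open>Exchanging \<open>a\<close> with the entry at position \<open>i\<close> is an involution on pairs of a word and a letter.\<close>
  have "(\<Sum>y\<in>words X L. \<Sum>a\<in>X. h (y[i := a])) = (\<Sum>(y, a)\<in>words X L \<times> X. h (y[i := a]))"
    by (simp add: sum.cartesian_product)
  also have "\<dots> = (\<Sum>(y, a)\<in>words X L \<times> X. h y)"
    by (rule sum.reindex_bij_witness[where i = "\<lambda>(y, a). (y[i := a], y ! i)"
          and j = "\<lambda>(y, a). (y[i := a], y ! i)"])
      (use assms in \<open>auto simp: words_list_update, auto simp: words_def subset_iff\<close>)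
  also have "\<dots> = of_nat (card X) * (\<Sum>y\<in>words X L. h y)"
    by (simp add: sum.cartesian_product[symmetric] sum_distrib_left)
  finally show ?thesis .
qed

text \<open>If \<open>f\<close> does not depend on the letter at position \<open>i\<close>, the sum over this letter can be performed on
  the matrix entries of the projection alone, and \<open>\<Sum>a. centred X a b = 0\<close>.\<close>

lemma project_constant_coordinate:
  assumes "i < L" and const: "\<And>x a. x \<in> words X L \<Longrightarrow> a \<in> X \<Longrightarrow> f (x[i := a]) = f x"
  shows "project X L f = 0"
proof
  fix x
  show "project X L f x = 0 x"
  proof (cases "x \<in> words X L")
    case True
    have "(\<Sum>a\<in>X. f (y[i := a]) * centred_tensor X (y[i := a]) x) = 0" if y: "y \<in> words X L" for y
    proof -
      have "f (y[i := a]) * centred_tensor X (y[i := a]) x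
          = f y * (\<Prod>l\<in>{..<L} - {i}. centred X (y ! l) (x ! l)) * centred X a (x ! i)" if "a \<in> X" for a
      proof -
        have "centred_tensor X (y[i := a]) x = (\<Prod>l<L. centred X (y[i := a] ! l) (x ! l))"
          using True y by (simp add: centred_tensor_eq words_def)
        also have "\<dots> = centred X (y[i := a] ! i) (x ! i)
            * (\<Prod>l\<in>{..<L} - {i}. centred X (y[i := a] ! l) (x ! l))"
          using assms(1) by (intro prod.remove) auto
        also have "(\<Prod>l\<in>{..<L} - {i}. centred X (y[i := a] ! l) (x ! l))
            = (\<Prod>l\<in>{..<L} - {i}. centred X (y ! l) (x ! l))"
          by (intro prod.cong) auto
        finally show ?thesis using y assms(1) const[OF y that] by (simp add: words_def)
      qed
      moreover have "x ! i \<in> X" using True assms(1) by (auto simp: words_def subset_iff)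
      ultimately show ?thesis by (simp add: sum_distrib_left[symmetric] sum_centred)
    qed
    then have "of_nat (card X) * project X L f x = 0"
      unfolding project_apply sum_words_update[OF assms(1), symmetric] by simp
    then show ?thesis by simp
  qed (simp add: project_outside)
qed

end


section \<open>Diagram functions\<close>

text \<open>Set partitions of the positions are represented by equivalence relations, because refinement then
  is inclusion, and the word \<open>xs\<close> is constant on the blocks of \<open>R\<close> if and only if
  \<open>R \<subseteq> kernel_rel xs\<close>. The singular relations are those of partitions with a block of size one.\<close>

definition kernel_rel :: "'x list \<Rightarrow> (nat \<times> nat) set"
  where "kernel_rel xs = {(i, j). i < length xs \<and> j < length xs \<and> xs ! i = xs ! j}"

definition equivalences :: "nat \<Rightarrow> (nat \<times> nat) set set"
  where "equivalences L = {R. equiv {..<L} R}"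

definition singular_equivalences :: "nat \<Rightarrow> (nat \<times> nat) set set"
  where "singular_equivalences L = {R \<in> equivalences L. \<exists>i<L. R `` {i} = {i}}"

definition diagram :: "'x set \<Rightarrow> nat \<Rightarrow> (nat \<times> nat) set \<Rightarrow> 'x list \<Rightarrow> complex"
  where "diagram X L R = (\<lambda>xs. of_bool (xs \<in> words X L \<and> R \<subseteq> kernel_rel xs))"

lemma equivalencesD:
  assumes "R \<in> equivalences L"
  shows "R \<subseteq> {..<L} \<times> {..<L}" "\<And>i. i < L \<Longrightarrow> (i, i) \<in> R"
    "\<And>i j. (i, j) \<in> R \<Longrightarrow> (j, i) \<in> R" "\<And>i j l. (i, j) \<in> R \<Longrightarrow> (j, l) \<in> R \<Longrightarrow> (i, l) \<in> R"
proof -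
  have R: "equiv {..<L} R" using assms by (simp add: equivalences_def)
  show "R \<subseteq> {..<L} \<times> {..<L}" using R by (rule equiv_type)
  show "(i, i) \<in> R" if "i < L" for i
    using R that by (simp add: equiv_def refl_on_def)
  show "(j, i) \<in> R" if "(i, j) \<in> R" for i j
    using R that by (auto simp: equiv_def dest: symD)
  show "(i, l) \<in> R" if "(i, j) \<in> R" "(j, l) \<in> R" for i j l
    using R that by (auto simp: equiv_def dest: transD)
qed

lemma equivalencesI:
  assumes "R \<subseteq> {..<L} \<times> {..<L}" "\<And>i. i < L \<Longrightarrow> (i, i) \<in> R"
    "\<And>i j. (i, j) \<in> R \<Longrightarrow> (j, i) \<in> R" "\<And>i j l. (i, j) \<in> R \<Longrightarrow> (j, l) \<in> R \<Longrightarrow> (i, l) \<in> R"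
  shows "R \<in> equivalences L"
  unfolding equivalences_def mem_Collect_eq
proof (rule equivI)
  show "R \<subseteq> {..<L} \<times> {..<L}" by fact
  show "refl_on {..<L} R" using assms(2) by (simp add: refl_on_def)
  show "sym R" using assms(3) by (rule symI)
  show "trans R" using assms(4) by (rule transI)
qed

lemma finite_equivalences [simp]: "finite (equivalences L)"
  by (rule finite_subset[of _ "Pow ({..<L} \<times> {..<L})"]) (use equivalencesD(1) in blast, simp)

lemma singular_subset: "singular_equivalences L \<subseteq> equivalences L"
  by (auto simp: singular_equivalences_def)

lemma finite_singular_equivalences [simp]: "finite (singular_equivalences L)"
  by (rule finite_subset[OF singular_subset finite_equivalences])

lemma kernel_rel_equivalence: "length xs = L \<Longrightarrow> kernel_rel xs \<in> equivalences L"
  by (rule equivalencesI) (auto simp: kernel_rel_def)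

text \<open>Here the alphabet must be large: each class needs its own letter.\<close>

lemma exists_word_kernel_rel:
  assumes "finite X" "L \<le> card X" "R \<in> equivalences L"
  shows "\<exists>xs\<in>words X L. kernel_rel xs = R"
proof -
  have eq: "equiv {..<L} R" using assms(3) by (simp add: equivalences_def)
  have Q: "{..<L} // R = (\<lambda>i. R `` {i}) ` {..<L}" by (auto simp: quotient_def)
  have "card ({..<L} // R) \<le> card X"
    using card_image_le[of "{..<L}" "\<lambda>i. R `` {i}"] assms(2) unfolding Q by simp
  moreover have "finite ({..<L} // R)" unfolding Q by simp
  ultimately obtain h where h: "h ` ({..<L} // R) \<subseteq> X" "inj_on h ({..<L} // R)"
    using card_le_inj[of "{..<L} // R" X] assms(1) by blast
  let ?xs = "map (\<lambda>i. h (R `` {i})) [0..<L]"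
  have "?xs \<in> words X L" using h(1) unfolding Q words_def by auto
  moreover have "kernel_rel ?xs = R"
  proof -
    have "(h (R `` {i}) = h (R `` {j})) = ((i, j) \<in> R)" if "i < L" "j < L" for i j
      using that h(2) equiv_class_eq_iff[OF eq, of i j] unfolding Q inj_on_def by auto
    then show ?thesis using equivalencesD(1)[OF assms(3)] by (auto simp: kernel_rel_def)
  qed
  ultimately show ?thesis by blast
qed

text \<open>Evaluate at a word whose kernel is a finest relation with nonzero coefficient: all other terms
  vanish there.\<close>

lemma diagram_coefficients_zero:
  assumes "finite X" "L \<le> card X"
    and zero: "(\<Sum>R\<in>equivalences L. cscale (c R) (diagram X L R)) = 0"
    and "R \<in> equivalences L"
  shows "c R = 0"
proof (rule ccontr)
  assume "c R \<noteq> 0"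
  let ?N = "{R \<in> equivalences L. c R \<noteq> 0}"
  have "finite ?N" "?N \<noteq> {}" using \<open>c R \<noteq> 0\<close> assms(4) by auto
  then obtain M where M: "M \<in> ?N" and min: "\<forall>S\<in>?N. S \<subseteq> M \<longrightarrow> M = S"
    by (blast dest: finite_has_minimal)
  obtain xs where xs: "xs \<in> words X L" "kernel_rel xs = M"
    using exists_word_kernel_rel[OF assms(1,2)] M by blast
  have "0 = (\<Sum>S\<in>equivalences L. c S * diagram X L S xs)"
    using fun_cong[OF zero, of xs] by (simp add: sum_fun_apply cscale_apply)
  also have "\<dots> = (\<Sum>S\<in>equivalences L. if S = M then c M else 0)"
  proof (rule sum.cong)
    fix S assume S: "S \<in> equivalences L"
    show "c S * diagram X L S xs = (if S = M then c M else 0)"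
    proof (cases "S \<subseteq> M")
      case True
      then show ?thesis using min S xs by (cases "c S = 0") (auto simp: diagram_def)
    qed (use xs in \<open>auto simp: diagram_def\<close>)
  qed simp
  also have "\<dots> = c M" using M by simp
  finally show False using M by simp
qed

text \<open>Moebius inversion in the lattice of equivalence relations, from coarse to fine, expresses the
  indicator functions of the sets of words with a given kernel.\<close>

lemma kernel_indicator_in_span:
  assumes "R \<in> equivalences L"
  shows "(\<lambda>xs. of_bool (xs \<in> words X L \<and> kernel_rel xs = R))
    \<in> cfun.span (diagram X L ` equivalences L)"
  using assms
proof (induction R rule: measure_induct_rule[of "\<lambda>R. card ({..<L} \<times> {..<L} - R)"])
  case (less R)
  define ind where "ind = (\<lambda>R xs. of_bool (xs \<in> words X L \<and> kernel_rel xs = R) :: complex)"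
  let ?C = "{S \<in> equivalences L. R \<subset> S}"
  have "card ({..<L} \<times> {..<L} - S) < card ({..<L} \<times> {..<L} - R)" if "S \<in> ?C" for S
  proof (rule psubset_card_mono)
    have "S \<subseteq> {..<L} \<times> {..<L}" using that equivalencesD(1)[of S L] by blast
    then show "{..<L} \<times> {..<L} - S \<subset> {..<L} \<times> {..<L} - R" using that by blast
  qed simp
  then have "ind S \<in> cfun.span (diagram X L ` equivalences L)" if "S \<in> ?C" for S
    unfolding ind_def by (rule less.IH) (use that in simp_all)
  then have "diagram X L R - (\<Sum>S\<in>?C. ind S) \<in> cfun.span (diagram X L ` equivalences L)"
    using less.prems
    by (intro cfun.span_diff cfun.span_sum cfun.span_base[of "diagram X L R"]) blast+
  moreover have "diagram X L R - (\<Sum>S\<in>?C. ind S) = ind R"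
  proof
    fix xs
    have "(\<Sum>S\<in>?C. ind S xs) = of_bool (xs \<in> words X L \<and> R \<subset> kernel_rel xs)"
    proof (cases "xs \<in> words X L")
      case True
      then have "kernel_rel xs \<in> equivalences L"
        by (intro kernel_rel_equivalence) (simp add: words_def)
      moreover have "(\<Sum>S\<in>?C. ind S xs) = (\<Sum>S\<in>?C. if S = kernel_rel xs then 1 else 0)"
        using True by (intro sum.cong) (auto simp: ind_def)
      ultimately show ?thesis using True by simp
    qed (simp add: ind_def)
    then show "(diagram X L R - (\<Sum>S\<in>?C. ind S)) xs = ind R xs"
      by (auto simp: sum_fun_apply diagram_def ind_def)
  qed
  ultimately show ?case by (simp add: ind_def)
qed

lemma kernel_function_in_span:
  assumes outside: "\<And>xs. xs \<notin> words X L \<Longrightarrow> f xs = 0"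
    and inv: "\<And>xs ys. xs \<in> words X L \<Longrightarrow> ys \<in> words X L \<Longrightarrow> kernel_rel xs = kernel_rel ys \<Longrightarrow> f xs = f ys"
  shows "f \<in> cfun.span (diagram X L ` equivalences L)"
proof -
  define g where "g R = f (SOME ys. ys \<in> words X L \<and> kernel_rel ys = R)" for R
  have g: "g (kernel_rel xs) = f xs" if "xs \<in> words X L" for xs
  proof -
    let ?ys = "SOME ys. ys \<in> words X L \<and> kernel_rel ys = kernel_rel xs"
    have "?ys \<in> words X L \<and> kernel_rel ?ys = kernel_rel xs"
      by (rule someI[of _ xs]) (use that in simp)
    then show ?thesis unfolding g_def using inv that by blast
  qed
  have "f = (\<Sum>R\<in>equivalences L. cscale (g R) (\<lambda>xs. of_bool (xs \<in> words X L \<and> kernel_rel xs = R)))"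
  proof
    fix xs
    show "f xs = (\<Sum>R\<in>equivalences L. cscale (g R) (\<lambda>xs. of_bool (xs \<in> words X L \<and> kernel_rel xs = R))) xs"
    proof (cases "xs \<in> words X L")
      case True
      then have "kernel_rel xs \<in> equivalences L"
        by (intro kernel_rel_equivalence) (simp add: words_def)
      moreover have "(\<Sum>R\<in>equivalences L. g R * of_bool (kernel_rel xs = R))
          = (\<Sum>R\<in>equivalences L. if R = kernel_rel xs then f xs else 0)"
        by (intro sum.cong) (auto simp: g[OF True])
      ultimately show ?thesis using True by (simp add: sum_fun_apply cscale_apply)
    qed (simp add: outside sum_fun_apply cscale_apply)
  qed
  moreover have "\<dots> \<in> cfun.span (diagram X L ` equivalences L)"
    by (intro cfun.span_sum cfun.span_scale kernel_indicator_in_span)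
  ultimately show ?thesis by simp
qed


section \<open>Projecting diagram functions\<close>

text \<open>The projection is the product over all positions \<open>i\<close> of the commuting operators that subtract from
  \<open>f\<close> its average over the letter at position \<open>i\<close>. The operator \<open>partial_project X L j\<close> is the product
  over the positions below \<open>j\<close>. Averaging a diagram function isolates the position \<open>i\<close> in its relation,
  up to a factor, and so yields a singular relation; hence the projection changes a combination
  of diagram functions only by singular ones.\<close>

definition average :: "'x set \<Rightarrow> nat \<Rightarrow> ('x list \<Rightarrow> complex) \<Rightarrow> 'x list \<Rightarrow> complex"
  where "average X i f = (\<lambda>xs. if set xs \<subseteq> X then (\<Sum>a\<in>X. f (xs[i := a])) / of_nat (card X) else 0)"

definition partial_project :: "'x set \<Rightarrow> nat \<Rightarrow> nat \<Rightarrow> ('x list \<Rightarrow> complex) \<Rightarrow> 'x list \<Rightarrow> complex"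
  where "partial_project X L j f = (\<lambda>x. if x \<in> words X L then
    \<Sum>y\<in>words X L. f y * (\<Prod>i<L. of_bool (y ! i = x ! i) - (if i < j then 1 / of_nat (card X) else 0))
    else 0)"

lemma average_add: "average X i (f + g) = average X i f + average X i g"
  by (auto simp: average_def sum.distrib add_divide_distrib)

lemma average_scale: "average X i (cscale c f) = cscale c (average X i f)"
  by (auto simp: average_def sum_distrib_left cscale_apply)

lemma average_zero: "average X i 0 = 0"
  by (auto simp: average_def)

lemma kernel_rel_update_fixed:
  assumes "R \<in> equivalences L" "R `` {i} = {i}" "length xs = L"
  shows "R \<subseteq> kernel_rel (xs[i := a]) \<longleftrightarrow> R \<subseteq> kernel_rel xs"
proof -
  have iff: "xs[i := a] ! p = xs[i := a] ! q \<longleftrightarrow> xs ! p = xs ! q" if "(p, q) \<in> R" for p q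
  proof -
    have "p = i \<longleftrightarrow> q = i"
      using that assms(2) equivalencesD(3)[OF assms(1)] by blast
    then show ?thesis by (cases "p = i") auto
  qed
  show ?thesis
    unfolding kernel_rel_def length_list_update subset_iff using iff by blast
qed

definition isolate :: "nat \<Rightarrow> (nat \<times> nat) set \<Rightarrow> (nat \<times> nat) set"
  where "isolate i R = insert (i, i) {(p, q) \<in> R. p \<noteq> i \<and> q \<noteq> i}"

lemma isolate_singular:
  assumes "R \<in> equivalences L" "i < L"
  shows "isolate i R \<in> singular_equivalences L"
proof -
  note D = equivalencesD[OF assms(1)]
  have "isolate i R \<in> equivalences L"
  proof (rule equivalencesI)
    show "isolate i R \<subseteq> {..<L} \<times> {..<L}" using D(1) assms(2) unfolding isolate_def by auto
    show "(p, p) \<in> isolate i R" if "p < L" for p using D(2)[OF that] unfolding isolate_def by auto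
    show "(q, p) \<in> isolate i R" if "(p, q) \<in> isolate i R" for p q
      using that D(3)[of p q] unfolding isolate_def by auto
    show "(p, s) \<in> isolate i R" if "(p, q) \<in> isolate i R" "(q, s) \<in> isolate i R" for p q s
      using that D(4)[of p q s] unfolding isolate_def by auto
  qed
  then show ?thesis using assms(2) by (auto simp: singular_equivalences_def isolate_def)
qed

text \<open>The letter put at position \<open>i\<close> must agree with the one at another position \<open>l\<close> of its class, so
  exactly one letter is possible in the average.\<close>

lemma kernel_rel_update_isolate:
  assumes "R \<in> equivalences L" "(i, l) \<in> R" "l \<noteq> i" "length xs = L"
  shows "R \<subseteq> kernel_rel (xs[i := a]) \<longleftrightarrow> isolate i R \<subseteq> kernel_rel xs \<and> a = xs ! l"
proof -
  note D = equivalencesD[OF assms(1)]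
  have il: "i < L" "l < L" using D(1) assms(2) by auto
  show ?thesis
  proof
    assume R: "R \<subseteq> kernel_rel (xs[i := a])"
    then have "(i, l) \<in> kernel_rel (xs[i := a])" using assms(2) by blast
    then have "a = xs ! l" using assms(3,4) il by (simp add: kernel_rel_def)
    moreover have "isolate i R \<subseteq> kernel_rel xs"
      using R assms(4) il by (fastforce simp: kernel_rel_def isolate_def subset_iff)
    ultimately show "isolate i R \<subseteq> kernel_rel xs \<and> a = xs ! l" by simp
  next
    assume A: "isolate i R \<subseteq> kernel_rel xs \<and> a = xs ! l"
    show "R \<subseteq> kernel_rel (xs[i := a])"
    proof (rule subrelI)
      fix p q assume pq: "(p, q) \<in> R"
      have lt: "p < L" "q < L" using D(1) pq by auto
      have other: "xs ! s = xs ! l" if "(i, s) \<in> R" "s \<noteq> i" for s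
      proof -
        have "(l, s) \<in> R" using D(3,4) that assms(2) by blast
        then have "(l, s) \<in> isolate i R" using that assms(3) by (simp add: isolate_def)
        then show ?thesis using A by (auto simp: kernel_rel_def)
      qed
      have "xs[i := a] ! p = xs[i := a] ! q"
      proof (cases "p = i"; cases "q = i")
        assume "p \<noteq> i" "q \<noteq> i"
        then have "(p, q) \<in> isolate i R" using pq by (simp add: isolate_def)
        then show ?thesis using A \<open>p \<noteq> i\<close> \<open>q \<noteq> i\<close> by (auto simp: kernel_rel_def)
      qed (use other pq D(3) A il assms(4) in auto)
      then show "(p, q) \<in> kernel_rel (xs[i := a])" using lt assms(4) by (simp add: kernel_rel_def)
    qed
  qed
qed

context alphabet
begin

lemma average_diagram_fixed:
  assumes "R \<in> equivalences L" "R `` {i} = {i}"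
  shows "average X i (diagram X L R) = diagram X L R"
proof
  fix xs
  show "average X i (diagram X L R) xs = diagram X L R xs"
  proof (cases "xs \<in> words X L")
    case True
    have "diagram X L R (xs[i := a]) = diagram X L R xs" if "a \<in> X" for a
      using kernel_rel_update_fixed[OF assms, of xs a] words_list_update[OF True that, of i] True
      by (simp add: diagram_def) (simp add: words_def)
    then show ?thesis using True by (simp add: average_def words_def)
  next
    case False
    then show ?thesis by (auto simp: average_def diagram_def words_def)
  qed
qed

lemma average_diagram_isolate:
  assumes "R \<in> equivalences L" "(i, l) \<in> R" "l \<noteq> i"
  shows "average X i (diagram X L R) = cscale (1 / of_nat (card X)) (diagram X L (isolate i R))"
proof
  fix xs
  show "average X i (diagram X L R) xs = cscale (1 / of_nat (card X)) (diagram X L (isolate i R)) xs"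
  proof (cases "xs \<in> words X L")
    case True
    have "l < L" using equivalencesD(1)[OF assms(1)] assms(2) by auto
    then have l: "xs ! l \<in> X" using True by (auto simp: words_def subset_iff)
    have "diagram X L R (xs[i := a])
        = (if a = xs ! l then of_bool (isolate i R \<subseteq> kernel_rel xs) else 0)" if "a \<in> X" for a
      using kernel_rel_update_isolate[OF assms, of xs a] words_list_update[OF True that, of i] True
      by (cases "a = xs ! l") (auto simp: diagram_def, auto simp: words_def)
    then have "(\<Sum>a\<in>X. diagram X L R (xs[i := a])) = of_bool (isolate i R \<subseteq> kernel_rel xs)"
      using l finite_alphabet by simp
    moreover have "diagram X L (isolate i R) xs = of_bool (isolate i R \<subseteq> kernel_rel xs)"
      using True by (simp add: diagram_def)
    ultimately show ?thesis using True by (simp add: average_def cscale_apply words_def)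
  next
    case False
    then show ?thesis by (auto simp: average_def diagram_def words_def cscale_apply)
  qed
qed

lemma average_diagram:
  assumes "R \<in> equivalences L" "i < L"
  shows "average X i (diagram X L R) \<in> cfun.span (diagram X L ` singular_equivalences L)"
proof (cases "R `` {i} = {i}")
  case True
  then have "R \<in> singular_equivalences L" using assms by (auto simp: singular_equivalences_def)
  then show ?thesis unfolding average_diagram_fixed[OF assms(1) True] by (intro cfun.span_base) simp
next
  case False
  then obtain l where "(i, l) \<in> R" "l \<noteq> i" using equivalencesD(2)[OF assms] by auto
  then show ?thesis
    unfolding average_diagram_isolate[OF assms(1) \<open>(i, l) \<in> R\<close> \<open>l \<noteq> i\<close>]
    by (intro cfun.span_scale cfun.span_base imageI isolate_singular assms)
qed

lemma average_span:
  assumes "f \<in> cfun.span (diagram X L ` equivalences L)" "i < L"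
  shows "average X i f \<in> cfun.span (diagram X L ` singular_equivalences L)"
  using assms(1)
proof (induction rule: cfun.span_induct)
  case base
  show ?case
    unfolding cfun.subspace_def mem_Collect_eq
    by (auto simp: average_add average_scale average_zero
        intro: cfun.span_zero cfun.span_add cfun.span_scale)
next
  case (step f)
  then show ?case using average_diagram[OF _ assms(2)] by auto
qed

lemma partial_project_0:
  assumes "\<And>x. x \<notin> words X L \<Longrightarrow> f x = 0"
  shows "partial_project X L 0 f = f"
proof
  fix x
  have "(\<Sum>y\<in>words X L. f y * (\<Prod>i<L. of_bool (y ! i = x ! i))) = f x" if x: "x \<in> words X L"
  proof -
    have "(\<Prod>i<L. of_bool (y ! i = x ! i)) = (if y = x then 1 else 0 :: complex)"
      if y: "y \<in> words X L" for y
    proof (cases "y = x")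
      case False
      then obtain i where "i < L" "y ! i \<noteq> x ! i"
        using x y by (auto simp: words_def list_eq_iff_nth_eq)
      then show ?thesis using False by (auto intro!: prod_zero)
    qed simp
    then have "(\<Sum>y\<in>words X L. f y * (\<Prod>i<L. of_bool (y ! i = x ! i)))
        = (\<Sum>y\<in>words X L. if y = x then f y else 0)"
      by (intro sum.cong) auto
    then show ?thesis using x by simp
  qed
  then show "partial_project X L 0 f x = f x" using assms by (simp add: partial_project_def)
qed

text \<open>The factors of the matrix at positions other than \<open>j\<close> are common to both sides (they form \<open>r\<close>
  below); at position \<open>j\<close> the factor \<open>\<delta>\<close> becomes \<open>\<delta> - 1 / n\<close>, where \<open>1 / n\<close> is the average of \<open>\<delta>\<close>.\<close>

lemma partial_project_Suc:
  assumes "j < L"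
  shows "partial_project X L (Suc j) f = partial_project X L j f - average X j (partial_project X L j f)"
proof
  fix x
  let ?n = "of_nat (card X) :: complex"
  define \<epsilon> where "\<epsilon> j i = (if i < j then 1 / ?n else 0)" for i j :: nat
  define q where "q j y x = (\<Prod>i<L. of_bool (y ! i = x ! i) - \<epsilon> j i)" for j and y x :: "'x list"
  define r where "r y = (\<Prod>i\<in>{..<L} - {j}. of_bool (y ! i = x ! i) - \<epsilon> j i)" for y :: "'x list"
  show "partial_project X L (Suc j) f x = (partial_project X L j f - average X j (partial_project X L j f)) x"
  proof (cases "x \<in> words X L")
    case True
    have pp: "partial_project X L j f z = (\<Sum>y\<in>words X L. f y * q j y z)" if "z \<in> words X L" for z j
      using that by (simp add: partial_project_def q_def \<epsilon>_def)
    have q_remove: "q m y z = (of_bool (y ! j = z ! j) - \<epsilon> m j)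
        * (\<Prod>i\<in>{..<L} - {j}. of_bool (y ! i = z ! i) - \<epsilon> m i)" for m y z
      unfolding q_def using assms by (intro prod.remove) auto
    have Suc: "q (Suc j) y x = (of_bool (y ! j = x ! j) - 1 / ?n) * r y" for y
      unfolding q_remove r_def by (intro arg_cong2[where f = "(*)"] prod.cong) (auto simp: \<epsilon>_def)
    have same: "q j y x = of_bool (y ! j = x ! j) * r y" for y
      unfolding q_remove r_def by (simp add: \<epsilon>_def)
    have upd: "q j y (x[j := a]) = of_bool (y ! j = a) * r y" for y a
    proof -
      have "(\<Prod>i\<in>{..<L} - {j}. of_bool (y ! i = x[j := a] ! i) - \<epsilon> j i) = r y"
        unfolding r_def by (intro prod.cong) auto
      moreover have "x[j := a] ! j = a" using True assms by (simp add: words_def)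
      ultimately show ?thesis unfolding q_remove by (simp add: \<epsilon>_def)
    qed
    have "average X j (partial_project X L j f) x
        = (\<Sum>a\<in>X. \<Sum>y\<in>words X L. f y * (of_bool (y ! j = a) * r y)) / ?n"
      using True words_list_update[OF True] by (simp add: average_def words_def[of X L] pp upd)
    also have "(\<Sum>a\<in>X. \<Sum>y\<in>words X L. f y * (of_bool (y ! j = a) * r y))
        = (\<Sum>y\<in>words X L. \<Sum>a\<in>X. f y * (of_bool (y ! j = a) * r y))"
      by (rule sum.swap)
    also have "\<dots> = (\<Sum>y\<in>words X L. f y * r y)"
    proof (rule sum.cong)
      fix y assume "y \<in> words X L"
      then have "y ! j \<in> X" using assms by (auto simp: words_def subset_iff)
      have "(\<Sum>a\<in>X. f y * (of_bool (y ! j = a) * r y)) = (\<Sum>a\<in>X. if a = y ! j then f y * r y else 0)"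
        by (intro sum.cong) auto
      then show "(\<Sum>a\<in>X. f y * (of_bool (y ! j = a) * r y)) = f y * r y"
        using \<open>y ! j \<in> X\<close> finite_alphabet by simp
    qed simp
    finally have "average X j (partial_project X L j f) x = (\<Sum>y\<in>words X L. f y * r y) / ?n" .
    then show ?thesis
      by (simp add: pp[OF True] Suc same sum_divide_distrib sum_subtractf[symmetric] algebra_simps)
  next
    case False
    then have "average X j (partial_project X L j f) x = 0"
      by (auto simp: average_def partial_project_def words_def)
    then show ?thesis using False by (simp add: partial_project_def)
  qed
qed

lemma partial_project_full: "partial_project X L L f = project X L f"
proof
  fix x
  show "partial_project X L L f x = project X L f x"
  proof (cases "x \<in> words X L")
    case True
    then show ?thesis by (simp add: partial_project_def project_apply centred_tensor_eq_words[OF True])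
  qed (simp add: partial_project_def project_outside)
qed

lemma project_modulo_singular:
  assumes f: "f \<in> cfun.span (diagram X L ` equivalences L)"
  shows "project X L f - f \<in> cfun.span (diagram X L ` singular_equivalences L)"
proof -
  have sub: "cfun.span (diagram X L ` singular_equivalences L) \<subseteq> cfun.span (diagram X L ` equivalences L)"
    by (intro cfun.span_mono image_mono singular_subset)
  have outside: "f x = 0" if "x \<notin> words X L" for x
    using f
  proof (induction rule: cfun.span_induct)
    case base
    show ?case by (auto simp: cfun.subspace_def cscale_apply)
  qed (use that in \<open>auto simp: diagram_def\<close>)
  have "partial_project X L j f - f \<in> cfun.span (diagram X L ` singular_equivalences L)" if "j \<le> L" for j
    using that
  proof (induction j)
    case 0
    have "partial_project X L 0 f = f" by (rule partial_project_0) (rule outside)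
    then show ?case by (simp only: diff_self cfun.span_zero)
  next
    case (Suc j)
    have IH: "partial_project X L j f - f \<in> cfun.span (diagram X L ` singular_equivalences L)"
      by (rule Suc.IH) (use Suc.prems in simp)
    then have "partial_project X L j f \<in> cfun.span (diagram X L ` equivalences L)"
      using cfun.span_add[OF subsetD[OF sub IH] f] by (simp only: diff_add_cancel)
    then have "average X j (partial_project X L j f) \<in> cfun.span (diagram X L ` singular_equivalences L)"
      using Suc by (intro average_span) auto
    moreover have "partial_project X L (Suc j) f - f
        = (partial_project X L j f - f) - average X j (partial_project X L j f)"
      using Suc by (simp add: partial_project_Suc fun_eq_iff)
    ultimately show ?case using cfun.span_diff[OF IH] by (simp only:)
  qed
  from this[of L] show ?thesis by (simp add: partial_project_full)
qed

lemma project_diagram_singular: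
  assumes "R \<in> singular_equivalences L"
  shows "project X L (diagram X L R) = 0"
proof -
  obtain i where R: "R \<in> equivalences L" "i < L" "R `` {i} = {i}"
    using assms by (auto simp: singular_equivalences_def)
  show ?thesis
  proof (rule project_constant_coordinate[OF R(2)])
    fix x a assume "x \<in> words X L" "a \<in> X"
    then show "diagram X L R (x[i := a]) = diagram X L R x"
      using kernel_rel_update_fixed[OF R(1,3), of x a] words_list_update[of x X L a i]
      by (simp add: diagram_def) (simp add: words_def)
  qed
qed

text \<open>If a combination \<open>f\<close> of nonsingular diagram functions projects to zero, then \<open>f = f - project X L f\<close>
  is a combination of singular ones, and all the diagram functions together are independent.\<close>

lemma project_diagram_coefficients_zero:
  assumes "L \<le> card X"
    and zero: "project X L (\<Sum>R\<in>equivalences L - singular_equivalences L. cscale (c R) (diagram X L R)) = 0"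
    and R: "R \<in> equivalences L - singular_equivalences L"
  shows "c R = 0"
proof -
  let ?NS = "equivalences L - singular_equivalences L" and ?d = "diagram X L"
  let ?f = "\<Sum>R\<in>?NS. cscale (c R) (?d R)"
  have "?f \<in> cfun.span (?d ` equivalences L)"
    by (intro cfun.span_sum cfun.span_scale cfun.span_base) auto
  from project_modulo_singular[OF this]
  have "- ?f \<in> cfun.span (?d ` singular_equivalences L)" unfolding zero by simp
  then obtain e where e: "- ?f = (\<Sum>R\<in>singular_equivalences L. cscale (e R) (?d R))"
    using cfun.span_image_eq_sums[OF finite_singular_equivalences] by blast
  let ?c = "\<lambda>R. if R \<in> singular_equivalences L then e R else c R"
  have "(\<Sum>R\<in>equivalences L. cscale (?c R) (?d R))
      = (\<Sum>R\<in>?NS. cscale (?c R) (?d R)) + (\<Sum>R\<in>singular_equivalences L. cscale (?c R) (?d R))"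
    by (rule sum.subset_diff[OF singular_subset]) simp
  also have "\<dots> = ?f + - ?f" unfolding e by (intro arg_cong2[where f = "(+)"] sum.cong) auto
  finally have "(\<Sum>R\<in>equivalences L. cscale (?c R) (?d R)) = 0" by simp
  from diagram_coefficients_zero[OF finite_alphabet assms(1) this, of R] R show ?thesis by auto
qed

end


section \<open>The commutant of a full symmetric group\<close>

definition word_act :: "('x \<Rightarrow> 'x) \<Rightarrow> ('x list \<Rightarrow> complex) \<Rightarrow> 'x list \<Rightarrow> complex"
  where "word_act g u = (\<lambda>xs. u (map (inv g) xs))"

definition apply_matrix ::
    "'x set \<Rightarrow> nat \<Rightarrow> ('x list \<Rightarrow> complex) \<Rightarrow> ('x list \<Rightarrow> complex) \<Rightarrow> 'x list \<Rightarrow> complex"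
  where "apply_matrix X k f u = (\<lambda>x. \<Sum>y\<in>words X k. f (x @ y) * u y)"

text \<open>A matrix indexed by pairs of words of length \<open>k\<close> is a function on words of length \<open>2 * k\<close>. It gives
  an endomorphism of the tensor power by restriction and projection; conversely, an endomorphism is
  determined by its values on the centred tensors, which span.\<close>

definition matrix_endo ::
    "'x set \<Rightarrow> nat \<Rightarrow> ('x list \<Rightarrow> complex) \<Rightarrow> ('x list \<Rightarrow> complex) \<Rightarrow> 'x list \<Rightarrow> complex"
  where "matrix_endo X k f = (\<lambda>u. if u \<in> tensor_power k (zero_sum X)
    then project X k (apply_matrix X k f u) else 0)"

definition endo_matrix ::
    "'x set \<Rightarrow> nat \<Rightarrow> (('x list \<Rightarrow> complex) \<Rightarrow> 'x list \<Rightarrow> complex) \<Rightarrow> 'x list \<Rightarrow> complex"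
  where "endo_matrix X k F = (\<lambda>z. if z \<in> words X (2 * k)
    then F (centred_tensor X (drop k z)) (take k z) else 0)"

lemma endomorphisms_sum:
  assumes "F \<in> endomorphisms U" "cfun.subspace U" "\<And>i. i \<in> I \<Longrightarrow> f i \<in> U"
  shows "F (\<Sum>i\<in>I. cscale (c i) (f i)) = (\<Sum>i\<in>I. cscale (c i) (F (f i)))"
proof -
  have add: "F (u + v) = F u + F v" if "u \<in> U" "v \<in> U" for u v
    using assms(1) that by (simp add: endomorphisms_def)
  have scale: "F (cscale a u) = cscale a (F u)" if "u \<in> U" for a u
    using assms(1) that by (simp add: endomorphisms_def)
  have zero: "F 0 = 0"
    using scale[of 0 0] cfun.subspace_0[OF assms(2)] by simp
  show ?thesis
    using assms(3)
  proof (induction I rule: infinite_finite_induct)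
    case (insert i I)
    then have "(\<Sum>i\<in>I. cscale (c i) (f i)) \<in> U" "cscale (c i) (f i) \<in> U" "f i \<in> U"
      using assms(2) by (auto intro!: cfun.subspace_sum cfun.subspace_scale)
    moreover have "F (\<Sum>i\<in>I. cscale (c i) (f i)) = (\<Sum>i\<in>I. cscale (c i) (F (f i)))"
      using insert by blast
    ultimately show ?case using insert(1,2) by (simp only: sum.insert add scale not_False_eq_True)
  qed (simp_all add: zero)
qed

lemma apply_matrix_add: "apply_matrix X k (f + f') u = apply_matrix X k f u + apply_matrix X k f' u"
  by (auto simp: apply_matrix_def distrib_right sum.distrib)

lemma apply_matrix_scale: "apply_matrix X k (cscale c f) u = cscale c (apply_matrix X k f u)"
  by (auto simp: apply_matrix_def cscale_apply sum_distrib_left mult.assoc)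

lemma apply_matrix_add_vector: "apply_matrix X k f (u + v) = apply_matrix X k f u + apply_matrix X k f v"
  by (auto simp: apply_matrix_def distrib_left sum.distrib)

lemma apply_matrix_scale_vector: "apply_matrix X k f (cscale c u) = cscale c (apply_matrix X k f u)"
  by (auto simp: apply_matrix_def cscale_apply sum_distrib_left mult_ac)

lemma matrix_endo_add: "matrix_endo X k (f + g) = matrix_endo X k f + matrix_endo X k g"
  by (rule ext) (simp add: matrix_endo_def apply_matrix_add project_add)

lemma matrix_endo_scale: "matrix_endo X k (cscale c f) = map_scale c (matrix_endo X k f)"
  by (rule ext) (simp add: matrix_endo_def apply_matrix_scale project_scale map_scale_apply)

lemma matrix_endo_zero: "matrix_endo X k 0 = 0"
  using matrix_endo_scale[of X k 0 0] by simp

lemma matrix_endo_sum: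
  "matrix_endo X k (\<Sum>i\<in>I. cscale (c i) (f i)) = (\<Sum>i\<in>I. map_scale (c i) (matrix_endo X k (f i)))"
  by (induction I rule: infinite_finite_induct)
    (simp_all only: sum.infinite sum.empty sum.insert not_False_eq_True
      matrix_endo_zero matrix_endo_add matrix_endo_scale)

lemma words_split:
  assumes "z \<in> words X (2 * k)"
  shows "take k z \<in> words X k" "drop k z \<in> words X k"
  using assms by (auto simp: words_def dest: in_set_takeD in_set_dropD)

context alphabet
begin

abbreviation tensors :: "nat \<Rightarrow> ('x list \<Rightarrow> complex) set"
  where "tensors k \<equiv> tensor_power k (zero_sum X)"

lemma matrix_endo_endomorphism: "matrix_endo X k f \<in> endomorphisms (tensors k)"
  unfolding endomorphisms_def mem_Collect_eq
proof (intro conjI allI ballI impI)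
  show "matrix_endo X k f u \<in> tensors k" if "u \<in> tensors k" for u
    using that by (simp add: matrix_endo_def project_in_tensor_power)
  show "matrix_endo X k f (u + v) = matrix_endo X k f u + matrix_endo X k f v"
    if "u \<in> tensors k" "v \<in> tensors k" for u v
    using that cfun.subspace_add[OF subspace_tensor_power that]
    by (simp add: matrix_endo_def apply_matrix_add_vector project_add)
  show "matrix_endo X k f (cscale c u) = cscale c (matrix_endo X k f u)" if "u \<in> tensors k" for u c
    using that cfun.subspace_scale[OF subspace_tensor_power that]
    by (simp add: matrix_endo_def apply_matrix_scale_vector project_scale)
  show "matrix_endo X k f u = 0" if "u \<notin> tensors k" for u
    using that by (simp add: matrix_endo_def)
qed

text \<open>Both the restriction to the tensor power in the source and the projection onto it in the target
  are centred tensors, so together they are the projection in all \<open>2 * k\<close> coordinates.\<close>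

lemma endo_matrix_matrix_endo: "endo_matrix X k (matrix_endo X k f) = project X (2 * k) f"
proof
  fix z
  show "endo_matrix X k (matrix_endo X k f) z = project X (2 * k) f z"
  proof (cases "z \<in> words X (2 * k)")
    case True
    define x0 y0 where "x0 = take k z" and "y0 = drop k z"
    have w: "x0 \<in> words X k" "y0 \<in> words X k"
      using words_split[OF True] by (simp_all add: x0_def y0_def)
    have "project X (2 * k) f z = (\<Sum>x\<in>words X k. \<Sum>y\<in>words X k. f (x @ y) * centred_tensor X (x @ y) (x0 @ y0))"
      unfolding project_apply mult_2 sum_words_append by (simp add: x0_def y0_def)
    also have "\<dots> = (\<Sum>x\<in>words X k. \<Sum>y\<in>words X k. f (x @ y) * centred_tensor X y0 y * centred_tensor X x x0)"
    proof (intro sum.cong refl)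
      fix x y assume xy: "x \<in> words X k" "y \<in> words X k"
      then have "length x0 = length x" using w by (simp add: words_def)
      then show "f (x @ y) * centred_tensor X (x @ y) (x0 @ y0)
          = f (x @ y) * centred_tensor X y0 y * centred_tensor X x x0"
        using centred_tensor_symmetric[OF w(2) xy(2)] by (simp add: centred_tensor_append)
    qed
    also have "\<dots> = matrix_endo X k f (centred_tensor X y0) x0"
      using centred_tensor_in_tensor_power[OF w(2)]
      by (simp add: matrix_endo_def project_apply apply_matrix_def sum_distrib_right)
    finally show ?thesis using True by (simp add: endo_matrix_def x0_def y0_def)
  qed (simp add: endo_matrix_def project_outside)
qed

lemma matrix_endo_endo_matrix:
  assumes F: "F \<in> endomorphisms (tensors k)"
  shows "matrix_endo X k (endo_matrix X k F) = F"
proof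
  fix u
  show "matrix_endo X k (endo_matrix X k F) u = F u"
  proof (cases "u \<in> tensors k")
    case True
    have Fu: "F u \<in> tensors k" using F True by (simp add: endomorphisms_def)
    have u: "F u = (\<Sum>y\<in>words X k. cscale (u y) (F (centred_tensor X y)))"
      using endomorphisms_sum[OF F subspace_tensor_power, of "words X k" "centred_tensor X" u]
        centred_tensor_in_tensor_power project_tensor_power[OF True]
      by (simp add: project_def)
    have "apply_matrix X k (endo_matrix X k F) u x = F u x" if "x \<in> words X k" for x
    proof -
      have "apply_matrix X k (endo_matrix X k F) u x
          = (\<Sum>y\<in>words X k. F (centred_tensor X y) x * u y)"
        unfolding apply_matrix_def
      proof (rule sum.cong)
        fix y assume "y \<in> words X k"
        then have "x @ y \<in> words X (2 * k)" using words_append[OF that] by (simp add: mult_2)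
        then show "endo_matrix X k F (x @ y) * u y = F (centred_tensor X y) x * u y"
          using that by (simp add: endo_matrix_def) (simp add: words_def)
      qed simp
      then show ?thesis unfolding u by (simp add: sum_fun_apply cscale_apply mult.commute)
    qed
    then have "project X k (apply_matrix X k (endo_matrix X k F) u) = project X k (F u)"
      by (rule project_cong)
    then have "matrix_endo X k (endo_matrix X k F) u = project X k (F u)"
      using True by (simp only: matrix_endo_def if_True)
    then show ?thesis by (simp add: project_tensor_power[OF Fu])
  next
    case False
    then show ?thesis using F by (simp add: matrix_endo_def endomorphisms_def)
  qed
qed

end

text \<open>The maps in \<open>G\<close> are bijections of the whole type, because a permutation of the entries acts on
  tabloids of every shape; on \<open>X\<close> they induce all permutations.\<close>

locale full_symmetric_action = alphabet X for X :: "'x set" +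
  fixes G :: "('x \<Rightarrow> 'x) set"
  assumes bij_action: "g \<in> G \<Longrightarrow> bij g"
    and image_action: "g \<in> G \<Longrightarrow> g ` X = X"
    and full_action: "bij_betw h X X \<Longrightarrow> \<exists>g\<in>G. \<forall>x\<in>X. g x = h x"
begin

definition commutant :: "nat \<Rightarrow> (('x list \<Rightarrow> complex) \<Rightarrow> 'x list \<Rightarrow> complex) set"
  where "commutant k = {F \<in> endomorphisms (tensors k).
    \<forall>g\<in>G. \<forall>u\<in>tensors k. F (word_act g u) = word_act g (F u)}"

lemma inv_in_alphabet: "g \<in> G \<Longrightarrow> inv g x \<in> X \<longleftrightarrow> x \<in> X"
  using image_action[of g] bij_action[of g]
  by (metis bij_inv_eq_iff image_eqI inj_image_mem_iff bij_is_inj)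

lemma map_words: "g \<in> G \<Longrightarrow> map g x \<in> words X L \<longleftrightarrow> x \<in> words X L"
  using image_action[of g] bij_action[of g]
  by (auto simp: words_def subset_iff) (metis inj_image_mem_iff bij_is_inj)+

lemma map_inv_words: "g \<in> G \<Longrightarrow> map (inv g) x \<in> words X L \<longleftrightarrow> x \<in> words X L"
  by (auto simp: words_def subset_iff inv_in_alphabet)

lemma map_inv_cancel:
  assumes "g \<in> G"
  shows "map (inv g) (map g x) = x" "map g (map (inv g) x) = x"
  using bij_action[OF assms]
  by (simp_all add: bij_is_inj bij_is_surj surj_f_inv_f map_idI)

lemma sum_words_act:
  assumes "g \<in> G"
  shows "(\<Sum>x\<in>words X L. f (map g x)) = (\<Sum>x\<in>words X L. f x)"
  by (rule sum.reindex_bij_witness[where i = "map (inv g)" and j = "map g"])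
    (simp_all only: map_words[OF assms] map_inv_words[OF assms] map_inv_cancel[OF assms])

lemma word_act_centred_tensor:
  assumes "g \<in> G"
  shows "word_act g (centred_tensor X y) = centred_tensor X (map g y)"
proof
  fix x
  have "centred X (y ! i) (inv g (x ! i)) = centred X (g (y ! i)) (x ! i)" for i
    using inv_in_alphabet[OF assms] bij_inv_eq_iff[OF bij_action[OF assms]]
    by (auto simp: centred_def)
  then show "word_act g (centred_tensor X y) x = centred_tensor X (map g y) x"
    by (auto simp: word_act_def centred_tensor_eq intro!: prod.cong)
qed

lemma word_act_project:
  assumes "g \<in> G"
  shows "word_act g (project X k v) = project X k (word_act g v)"
proof
  fix x
  have "project X k (word_act g v) x = (\<Sum>y\<in>words X k. word_act g v (map g y) * centred_tensor X (map g y) x)"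
    unfolding project_apply by (rule sum_words_act[OF assms, symmetric])
  also have "\<dots> = (\<Sum>y\<in>words X k. v y * word_act g (centred_tensor X y) x)"
    unfolding word_act_centred_tensor[OF assms]
    by (simp only: word_act_def map_inv_cancel[OF assms])
  also have "\<dots> = word_act g (project X k v) x"
    by (simp add: word_act_def project_apply)
  finally show "word_act g (project X k v) x = project X k (word_act g v) x" by simp
qed

lemma word_act_tensors:
  assumes "g \<in> G" "u \<in> tensors k"
  shows "word_act g u \<in> tensors k"
  using project_in_tensor_power[of k "word_act g u"] word_act_project[OF assms(1), of k u]
  by (simp add: project_tensor_power[OF assms(2)])

lemma matrix_endo_commutant:
  assumes inv: "\<And>g z. g \<in> G \<Longrightarrow> z \<in> words X (2 * k) \<Longrightarrow> f (map g z) = f z"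
  shows "matrix_endo X k f \<in> commutant k"
proof -
  have "matrix_endo X k f (word_act g u) = word_act g (matrix_endo X k f u)"
    if g: "g \<in> G" and u: "u \<in> tensors k" for g u
  proof -
    have "project X k (apply_matrix X k f (word_act g u)) = project X k (word_act g (apply_matrix X k f u))"
    proof (rule project_cong)
      fix x assume x: "x \<in> words X k"
      have "apply_matrix X k f (word_act g u) x
          = (\<Sum>y\<in>words X k. f (x @ map g y) * word_act g u (map g y))"
        unfolding apply_matrix_def by (rule sum_words_act[OF g, symmetric])
      also have "\<dots> = (\<Sum>y\<in>words X k. f (map (inv g) x @ y) * u y)"
      proof (rule sum.cong)
        fix y assume y: "y \<in> words X k"
        have "map (inv g) x @ y \<in> words X (2 * k)"
          using words_append[of "map (inv g) x" X k y k] x y map_inv_words[OF g] by (simp add: mult_2)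
        from inv[OF g this] have "f (x @ map g y) = f (map (inv g) x @ y)"
          by (simp only: map_append map_inv_cancel[OF g])
        then show "f (x @ map g y) * word_act g u (map g y) = f (map (inv g) x @ y) * u y"
          by (simp only: word_act_def map_inv_cancel[OF g])
      qed simp
      finally show "apply_matrix X k f (word_act g u) x = word_act g (apply_matrix X k f u) x"
        by (simp add: apply_matrix_def word_act_def)
    qed
    then show ?thesis
      using word_act_tensors[OF g u] u by (simp add: matrix_endo_def word_act_project[OF g])
  qed
  then show ?thesis using matrix_endo_endomorphism by (simp add: commutant_def)
qed

lemma diagram_invariant:
  assumes "g \<in> G"
  shows "diagram X L R (map g z) = diagram X L R z"
proof -
  have "inj g" using bij_action[OF assms] by (rule bij_is_inj)
  then have "kernel_rel (map g z) = kernel_rel z" by (auto simp: kernel_rel_def inj_eq)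
  then show ?thesis by (simp add: diagram_def map_words[OF assms])
qed

text \<open>Two words with the same kernel are related by an injection between their sets of letters, which
  extends to a bijection of the finite alphabet.\<close>

lemma same_kernel_same_orbit:
  assumes z: "z \<in> words X L" and z': "z' \<in> words X L" and ker: "kernel_rel z = kernel_rel z'"
  shows "\<exists>g\<in>G. z' = map g z"
proof -
  have len: "length z = L" "length z' = L" and sub: "set z \<subseteq> X" "set z' \<subseteq> X"
    using z z' by (auto simp: words_def)
  have iff: "z ! i = z ! j \<longleftrightarrow> z' ! i = z' ! j" if "i < L" "j < L" for i j
  proof -
    have "(i, j) \<in> kernel_rel z \<longleftrightarrow> (i, j) \<in> kernel_rel z'" using ker by simp
    then show ?thesis using that len by (simp add: kernel_rel_def)
  qed
  define h where "h x = z' ! (SOME i. i < L \<and> z ! i = x)" for x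
  have h: "h (z ! i) = z' ! i" if "i < L" for i
  proof -
    let ?j = "SOME j. j < L \<and> z ! j = z ! i"
    have "?j < L \<and> z ! ?j = z ! i" by (rule someI[of _ i]) (use that in simp)
    then show ?thesis using iff[of ?j i] that by (simp add: h_def)
  qed
  have map_h: "map h z = z'" by (rule nth_equalityI) (simp_all add: len h)
  have inj_h: "inj_on h (set z)"
    by (rule inj_onI) (use h iff len in \<open>auto simp: in_set_conv_nth\<close>)
  have "card (X - set z) = card (X - set z')"
    using card_image[OF inj_h] sub map_h
    by (simp add: card_Diff_subset set_map[symmetric] del: set_map)
  then obtain h' where h': "bij_betw h' (X - set z) (X - set z')"
    using finite_same_card_bij[of "X - set z" "X - set z'"] finite_alphabet by auto
  have bh: "bij_betw h (set z) (set z')"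
    using inj_h map_h by (auto simp: bij_betw_def)
  let ?p = "\<lambda>x. if x \<in> set z then h x else h' x"
  have "bij_betw ?p (set z \<union> (X - set z)) (set z' \<union> (X - set z'))"
  proof (rule bij_betw_combine)
    show "bij_betw ?p (set z) (set z')" using bh by (simp cong: bij_betw_cong)
    have "bij_betw ?p (X - set z) (X - set z') = bij_betw h' (X - set z) (X - set z')"
      by (rule bij_betw_cong) simp
    then show "bij_betw ?p (X - set z) (X - set z')" using h' by simp
  qed auto
  then have "bij_betw ?p X X" using sub by (simp add: Un_absorb1)
  then obtain g where g: "g \<in> G" "\<forall>x\<in>X. g x = ?p x" using full_action by blast
  have "map g z = map h z" using g(2) sub by (intro map_cong) auto
  then show ?thesis using g(1) map_h by auto
qed

text \<open>The matrix of an equivariant endomorphism is constant on the orbits of pairs of words, that is, on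
  the sets of words of length \<open>2 * k\<close> with a given kernel.\<close>

lemma endo_matrix_in_diagram_span:
  assumes "F \<in> commutant k"
  shows "endo_matrix X k F \<in> cfun.span (diagram X (2 * k) ` equivalences (2 * k))"
proof (rule kernel_function_in_span)
  show "endo_matrix X k F z = 0" if "z \<notin> words X (2 * k)" for z
    using that by (simp add: endo_matrix_def)
  fix z z' assume zz: "z \<in> words X (2 * k)" "z' \<in> words X (2 * k)" "kernel_rel z = kernel_rel z'"
  then obtain g where g: "g \<in> G" "z' = map g z" using same_kernel_same_orbit by blast
  let ?c = "centred_tensor X (drop k z)"
  have "?c \<in> tensors k" using words_split[OF zz(1)] by (intro centred_tensor_in_tensor_power)
  then have "F (word_act g ?c) = word_act g (F ?c)" using assms g(1) by (simp add: commutant_def)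
  then have "F (centred_tensor X (drop k z')) (take k z') = word_act g (F ?c) (map g (take k z))"
    by (simp add: g(2) drop_map take_map word_act_centred_tensor[OF g(1)])
  also have "\<dots> = F ?c (take k z)"
    by (simp only: word_act_def map_inv_cancel[OF g(1)])
  finally show "endo_matrix X k F z = endo_matrix X k F z'" using zz by (simp add: endo_matrix_def)
qed

lemma matrix_endo_diagram_singular:
  assumes "R \<in> singular_equivalences (2 * k)"
  shows "matrix_endo X k (diagram X (2 * k) R) = 0"
  using matrix_endo_endo_matrix[OF matrix_endo_endomorphism, of k "diagram X (2 * k) R"]
  by (simp add: endo_matrix_matrix_endo project_diagram_singular[OF assms] matrix_endo_zero)

theorem dim_commutant:
  assumes "2 * k \<le> card X"
  shows "cmap.dim (commutant k) = card (equivalences (2 * k) - singular_equivalences (2 * k))"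
proof (rule cmap.dim_eq_card_family)
  let ?NS = "equivalences (2 * k) - singular_equivalences (2 * k)"
  let ?e = "\<lambda>R. matrix_endo X k (diagram X (2 * k) R)"
  show "finite ?NS" by simp
  show "?e ` ?NS \<subseteq> commutant k"
    by (auto intro!: matrix_endo_commutant simp: diagram_invariant)
  show "commutant k \<subseteq> cmap.span (?e ` ?NS)"
  proof
    fix F assume F: "F \<in> commutant k"
    then obtain c where c: "endo_matrix X k F = (\<Sum>R\<in>equivalences (2 * k). cscale (c R) (diagram X (2 * k) R))"
      using cfun.span_image_eq_sums[OF finite_equivalences endo_matrix_in_diagram_span] by blast
    have "F = (\<Sum>R\<in>equivalences (2 * k). map_scale (c R) (?e R))"
      using matrix_endo_endo_matrix[of F k] F unfolding c matrix_endo_sum by (simp add: commutant_def)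
    also have "\<dots> = (\<Sum>R\<in>?NS. map_scale (c R) (?e R))"
      by (rule sum.mono_neutral_right) (auto simp: matrix_endo_diagram_singular)
    also have "\<dots> \<in> cmap.span (?e ` ?NS)"
      by (intro cmap.span_sum cmap.span_scale cmap.span_base imageI)
    finally show "F \<in> cmap.span (?e ` ?NS)" .
  qed
  fix c R assume zero: "(\<Sum>R\<in>?NS. map_scale (c R) (?e R)) = 0" and R: "R \<in> ?NS"
  have "endo_matrix X k 0 = 0" by (auto simp: endo_matrix_def)
  then have "project X (2 * k) (\<Sum>R\<in>?NS. cscale (c R) (diagram X (2 * k) R)) = 0"
    unfolding endo_matrix_matrix_endo[symmetric] matrix_endo_sum zero .
  then show "c R = 0" by (rule project_diagram_coefficients_zero[OF assms]) fact
qed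

end


section \<open>Singleton-free partitions and Bell numbers\<close>

definition singleton_free_partitions :: "'a set \<Rightarrow> 'a set set set"
  where "singleton_free_partitions A = {P. partition_on A P \<and> (\<forall>b\<in>P. card b \<noteq> 1)}"

lemma finite_singleton_free_partitions: "finite A \<Longrightarrow> finite (singleton_free_partitions A)"
  unfolding singleton_free_partitions_def
  by (rule finite_subset[OF _ finitely_many_partition_on[of A]]) auto

lemma partition_on_image:
  assumes "partition_on A P" "inj_on f A"
  shows "partition_on (f ` A) ((`) f ` P)"
proof -
  have "(`) f ` P - {{}} = (`) f ` P"
    using partition_onD3[OF assms(1)] by auto
  then show ?thesis using partition_on_inj_image[OF assms] by simp
qed

lemma image_singleton_free_partitions:
  assumes "inj_on f A" "P \<in> singleton_free_partitions A"
  shows "(`) f ` P \<in> singleton_free_partitions (f ` A)"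
proof -
  have P: "partition_on A P" "\<forall>b\<in>P. card b \<noteq> 1"
    using assms(2) by (auto simp: singleton_free_partitions_def)
  have "card (f ` b) = card b" if "b \<in> P" for b
    using that partition_onD1[OF P(1)] assms(1) by (intro card_image) (auto intro: inj_on_subset)
  then show ?thesis
    using partition_on_image[OF P(1) assms(1)] P(2) by (auto simp: singleton_free_partitions_def)
qed

lemma card_singleton_free_partitions_cong:
  assumes "bij_betw f A B"
  shows "card (singleton_free_partitions A) = card (singleton_free_partitions B)"
proof -
  define g where "g = inv_into A f"
  have f: "inj_on f A" "f ` A = B" and g: "inj_on g B" "g ` B = A"
    using assms bij_betw_inv_into[OF assms] by (auto simp: bij_betw_def g_def)
  have gf: "g (f x) = x" if "x \<in> A" for x
    using that f by (simp add: g_def)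
  have fg: "f (g x) = x" if "x \<in> B" for x
    using that f by (auto simp: g_def intro: f_inv_into_f)
  have cancel: "(`) h ` (`) h' ` P = P"
    if "partition_on C P" "\<And>x. x \<in> C \<Longrightarrow> h (h' x) = x" for h :: "'x \<Rightarrow> 'y" and h' P C
  proof -
    have "h ` h' ` b = b" if "b \<in> P" for b
    proof -
      have "b \<subseteq> C" using that partition_onD1[OF \<open>partition_on C P\<close>] by auto
      then have "h (h' x) = x" if "x \<in> b" for x
        using that \<open>\<And>x. x \<in> C \<Longrightarrow> h (h' x) = x\<close> by blast
      then show ?thesis by (simp add: image_image)
    qed
    then show ?thesis by (auto simp: image_image)
  qed
  have "bij_betw ((`) ((`) f)) (singleton_free_partitions A) (singleton_free_partitions B)"
  proof (rule bij_betw_byWitness[where f' = "(`) ((`) g)"])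
    show "\<forall>P\<in>singleton_free_partitions A. (`) g ` (`) f ` P = P"
      using gf by (auto intro!: cancel simp: singleton_free_partitions_def)
    show "\<forall>P\<in>singleton_free_partitions B. (`) f ` (`) g ` P = P"
      using fg by (auto intro!: cancel simp: singleton_free_partitions_def)
    show "(`) ((`) f) ` singleton_free_partitions A \<subseteq> singleton_free_partitions B"
      using image_singleton_free_partitions[OF f(1)] f(2) by blast
    show "(`) ((`) g) ` singleton_free_partitions B \<subseteq> singleton_free_partitions A"
      using image_singleton_free_partitions[OF g(1)] g(2) by blast
  qed
  then show ?thesis by (rule bij_betw_same_card)
qed

lemma partition_block_unique:
  assumes "partition_on A P" "b \<in> P" "c \<in> P" "x \<in> b" "x \<in> c"
  shows "b = c"
  using assms by (auto simp: partition_on_def disjoint_def)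

text \<open>Given a partition of \<open>A\<close> with at least one singleton block, merge all the singletons with the new
  point \<open>x\<close>; to undo this, remove \<open>x\<close> from its block and split the rest of that block into single
  points. The block of \<open>x\<close> obtained in this way is not \<open>{x}\<close>, because there is a singleton to merge.\<close>

lemma card_partitions_with_singleton:
  assumes "x \<notin> A"
  shows "card {P. partition_on A P \<and> (\<exists>b\<in>P. card b = 1)}
    = card (singleton_free_partitions (insert x A))"
    (is "card ?D = card ?S")
proof -
  define merge where
    "merge P = insert (insert x {y. {y} \<in> P}) {b\<in>P. card b \<noteq> 1}" for P :: "'a set set"
  define split where
    "split Q = {b\<in>Q. x \<notin> b} \<union> (\<lambda>y. {y}) ` {y. y \<noteq> x \<and> (\<exists>b\<in>Q. x \<in> b \<and> y \<in> b)}" for Q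
  have 1: "merge P \<in> ?S" if P: "P \<in> ?D" for P
  proof -
    have p: "partition_on A P" and s: "\<exists>b\<in>P. card b = 1" using P by auto
    let ?Y = "{y. {y} \<in> P}"
    have Ysub: "?Y \<subseteq> A" using partition_onD1[OF p] by auto
    have Yne: "?Y \<noteq> {}" using s by (auto simp: card_1_singleton_iff)
    have "\<Union>(merge P) = insert x A"
    proof -
      have "\<Union>P \<subseteq> ?Y \<union> \<Union>{b\<in>P. card b \<noteq> 1}" by (force simp: card_1_singleton_iff)
      then show ?thesis using Ysub partition_onD1[OF p] unfolding merge_def by auto
    qed
    moreover have "disjoint (merge P)"
    proof -
      have "insert x ?Y \<inter> b = {}" if "b \<in> P" "card b \<noteq> 1" for b
        using that partition_block_unique[OF p] assms partition_onD1[OF p]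
        by (auto simp: card_1_singleton_iff)
      then show ?thesis
        using partition_onD2[OF p] by (auto simp: merge_def disjoint_def)
    qed
    moreover have "{} \<notin> merge P" using partition_onD3[OF p] by (auto simp: merge_def)
    moreover have "card b \<noteq> 1" if "b \<in> merge P" for b
    proof -
      have "insert x ?Y \<noteq> {z}" for z using Yne Ysub assms by auto
      then show ?thesis using that by (auto simp: merge_def card_1_singleton_iff)
    qed
    ultimately show ?thesis by (auto simp: singleton_free_partitions_def partition_on_def)
  qed
  have 2: "split Q \<in> ?D" if Q: "Q \<in> ?S" for Q
  proof -
    have q: "partition_on (insert x A) Q" and s: "\<forall>b\<in>Q. card b \<noteq> 1"
      using Q by (auto simp: singleton_free_partitions_def)
    obtain B where B: "B \<in> Q" "x \<in> B" using partition_onD1[OF q] by blast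
    have BU: "b = B" if "b \<in> Q" "x \<in> b" for b
      using partition_block_unique[OF q that(1) B(1) that(2) B(2)] .
    have sp: "split Q = (Q - {B}) \<union> (\<lambda>y. {y}) ` (B - {x})"
    proof -
      have "{b\<in>Q. x \<notin> b} = Q - {B}" "{y. y \<noteq> x \<and> (\<exists>b\<in>Q. x \<in> b \<and> y \<in> b)} = B - {x}"
        using B BU by blast+
      then show ?thesis unfolding split_def by simp
    qed
    have "B \<noteq> {x}" using s B by auto
    then obtain y where y: "y \<in> B" "y \<noteq> x" using B by auto
    have dis: "b \<inter> B = {}" if "b \<in> Q - {B}" for b
      using that partition_onD2[OF q] B by (auto simp: disjoint_def)
    have "\<Union>(split Q) = A"
    proof -
      have x: "x \<notin> \<Union>(Q - {B})" using dis B by blast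
      have "\<Union>(split Q) = \<Union>(Q - {B}) \<union> (B - {x})" unfolding sp by auto
      also have "\<dots> = \<Union>(Q - {B}) \<union> B - {x}" using x by blast
      also have "\<Union>(Q - {B}) \<union> B = \<Union>Q" using B(1) by blast
      also have "\<dots> = insert x A" using partition_onD1[OF q] by simp
      finally show ?thesis using assms by simp
    qed
    moreover have "disjoint (split Q)"
      using partition_onD2[OF q] dis unfolding sp disjoint_def by auto
    moreover have "{} \<notin> split Q" using partition_onD3[OF q] by (auto simp: sp)
    moreover have "{y} \<in> split Q" using y by (auto simp: sp)
    ultimately show ?thesis by (auto simp: partition_on_def intro!: bexI[of _ "{y}"])
  qed
  have 3: "split (merge P) = P" if P: "P \<in> ?D" for P
  proof -
    have p: "partition_on A P" using P by auto
    have x: "x \<notin> b" if "b \<in> P" for b using that partition_onD1[OF p] assms by auto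
    then have "{b\<in>merge P. x \<notin> b} = {b\<in>P. card b \<noteq> 1}" unfolding merge_def by auto
    moreover have "{y. y \<noteq> x \<and> (\<exists>b\<in>merge P. x \<in> b \<and> y \<in> b)} = {y. {y} \<in> P}"
      using x unfolding merge_def by auto
    moreover have "(\<lambda>y. {y}) ` {y. {y} \<in> P} = {b\<in>P. card b = 1}" by (auto simp: card_1_singleton_iff)
    ultimately have "split (merge P) = {b\<in>P. card b \<noteq> 1} \<union> {b\<in>P. card b = 1}"
      unfolding split_def by simp
    also have "\<dots> = P" by blast
    finally show ?thesis .
  qed
  have 4: "merge (split Q) = Q" if Q: "Q \<in> ?S" for Q
  proof -
    have q: "partition_on (insert x A) Q" and s: "\<forall>b\<in>Q. card b \<noteq> 1"
      using Q by (auto simp: singleton_free_partitions_def)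
    obtain B where B: "B \<in> Q" "x \<in> B" using partition_onD1[OF q] by blast
    have BU: "b = B" if "b \<in> Q" "x \<in> b" for b
      using partition_block_unique[OF q that(1) B(1) that(2) B(2)] .
    have sp: "split Q = (Q - {B}) \<union> (\<lambda>y. {y}) ` (B - {x})"
    proof -
      have "{b\<in>Q. x \<notin> b} = Q - {B}" "{y. y \<noteq> x \<and> (\<exists>b\<in>Q. x \<in> b \<and> y \<in> b)} = B - {x}"
        using B BU by blast+
      then show ?thesis unfolding split_def by simp
    qed
    have not1: "{y} \<notin> Q" for y
    proof
      assume "{y} \<in> Q"
      with s have "card {y} \<noteq> 1" by blast
      then show False by simp
    qed
    have "{y. {y} \<in> split Q} = B - {x}" unfolding sp using not1 by auto
    moreover have "{b\<in>split Q. card b \<noteq> 1} = Q - {B}" unfolding sp using s by auto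
    moreover have "insert x (B - {x}) = B" using B(2) by blast
    ultimately have "merge (split Q) = insert B (Q - {B})" unfolding merge_def by simp
    then show ?thesis by (simp only: insert_Diff[OF B(1)])
  qed
  have "bij_betw merge ?D ?S"
  proof (rule bij_betw_byWitness[where f' = split])
    show "\<forall>P\<in>?D. split (merge P) = P" using 3 by blast
    show "\<forall>Q\<in>?S. merge (split Q) = Q" using 4 by blast
    show "merge ` ?D \<subseteq> ?S" using 1 by blast
    show "split ` ?S \<subseteq> ?D" using 2 by blast
  qed
  then show ?thesis by (rule bij_betw_same_card)
qed

lemma card_partitions_split:
  assumes "finite A" "x \<notin> A"
  shows "card {P. partition_on A P}
    = card (singleton_free_partitions A) + card (singleton_free_partitions (insert x A))"
proof -
  have "{P. partition_on A P}
      = singleton_free_partitions A \<union> {P. partition_on A P \<and> (\<exists>b\<in>P. card b = 1)}"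
    by (auto simp: singleton_free_partitions_def)
  moreover have "finite {P. partition_on A P \<and> (\<exists>b\<in>P. card b = 1)}"
    by (rule finite_subset[OF _ finitely_many_partition_on[OF assms(1)]]) auto
  moreover have "singleton_free_partitions A \<inter> {P. partition_on A P \<and> (\<exists>b\<in>P. card b = 1)} = {}"
    by (auto simp: singleton_free_partitions_def)
  ultimately show ?thesis
    using finite_singleton_free_partitions[OF assms(1)] card_partitions_with_singleton[OF assms(2)]
    by (simp add: card_Un_disjoint)
qed

text \<open>Solving the recursion \<open>B(m) = a(m) + a(m + 1)\<close> for the number \<open>a(m)\<close> of singleton-free partitions
  of \<open>m\<close> points, from \<open>a(0) = 1\<close>, gives the alternating sum.\<close>

lemma card_singleton_free_partitions_bell:
  "int (card (singleton_free_partitions {..<m}))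
    = (\<Sum>j = 1..m. (- 1) ^ (j - 1) * int (bell (m - j))) + (- 1) ^ m"
proof (induction m)
  case 0
  have "singleton_free_partitions {} = {{} :: nat set set}"
    by (auto simp: singleton_free_partitions_def partition_on_empty)
  then show ?case by simp
next
  case (Suc m)
  have "bell m = card (singleton_free_partitions {..<m}) + card (singleton_free_partitions {..<Suc m})"
    using card_partitions_split[of "{..<m}" m] by (simp add: bell_def lessThan_Suc)
  moreover have "(\<Sum>j = 1..Suc m. (- 1) ^ (j - 1) * int (bell (Suc m - j)))
      = int (bell m) - (\<Sum>j = 1..m. (- 1) ^ (j - 1) * int (bell (m - j)))"
  proof -
    have "(\<Sum>j = 1..Suc m. (- 1) ^ (j - 1) * int (bell (Suc m - j)))
        = (\<Sum>j = 0..m. (- 1) ^ j * int (bell (m - j)))"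
      using sum.atLeast_Suc_atMost_Suc_shift[of "\<lambda>j. (- 1) ^ (j - 1) * int (bell (Suc m - j))" 0 m]
      by (simp del: sum.cl_ivl_Suc)
    also have "\<dots> = int (bell m) + (\<Sum>j = 1..m. (- 1) ^ j * int (bell (m - j)))"
      by (simp add: sum.atLeast_Suc_atMost)
    also have "(\<Sum>j = 1..m. (- 1) ^ j * int (bell (m - j)))
        = - (\<Sum>j = 1..m. (- 1) ^ (j - 1) * int (bell (m - j)))"
      unfolding sum_negf[symmetric]
    proof (rule sum.cong)
      fix j assume "j \<in> {1..m}"
      then obtain i where "j = Suc i" by (cases j) auto
      then show "(- 1) ^ j * int (bell (m - j)) = - ((- 1) ^ (j - 1) * int (bell (m - j)))" by simp
    qed simp
    finally show ?thesis by simp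
  qed
  ultimately show ?case using Suc by simp
qed


section \<open>The Specht module of a hook with one box in the second row\<close>

definition standard_tabloid :: "nat \<Rightarrow> nat \<Rightarrow> tabloid"
  where "standard_tabloid n b = [{..<n} - {b}, {b}]"

lemma inj_standard_tabloid: "inj_on (standard_tabloid n) A"
  by (rule inj_onI) (simp add: standard_tabloid_def)

lemma standard_tabloid_eq_iff: "standard_tabloid n a = standard_tabloid n b \<longleftrightarrow> a = b"
  by (auto simp: standard_tabloid_def)

text \<open>The left-hand side is the form into which the simplifier brings \<open>cells [n - 1, 1]\<close>.\<close>

lemma cells_hook: "cells [n - Suc 0, Suc 0] = {0} \<times> {..<n - 1} \<union> {(Suc 0, 0)}"
  by (auto simp: cells_def less_Suc_eq)

lemma tabloid_of_hook:
  assumes "n \<ge> 2" "t \<in> tableaux [n - 1, 1]"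
  shows "tabloid_of [n - 1, 1] t = standard_tabloid n (t (1, 0))"
proof -
  have bij: "bij_betw t (cells [n - 1, 1]) {..<n}" using assms by (simp add: tableaux_def)
  have r1: "row [n - 1, 1] t 1 = {t (1, 0)}"
  proof -
    have "{(a, b) \<in> cells [n - 1, 1]. a = 1} = {(1, 0)}" by (auto simp: cells_hook)
    then show ?thesis by (simp add: row_def)
  qed
  have r0: "row [n - 1, 1] t 0 = {..<n} - {t (1, 0)}"
  proof -
    have "{(a, b) \<in> cells [n - 1, 1]. a = 0} = cells [n - 1, 1] - {(1, 0)}" by (auto simp: cells_hook)
    moreover have "t ` (cells [n - 1, 1] - {(1, 0)}) = t ` cells [n - 1, 1] - t ` {(1, 0)}"
      by (rule inj_on_image_set_diff[OF bij_betw_imp_inj_on[OF bij]]) (auto simp: cells_hook)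
    ultimately show ?thesis using bij_betw_imp_surj_on[OF bij] by (simp add: row_def)
  qed
  have "[0..<length [n - 1, 1]] = [0, 1]" by (simp add: upt_rec)
  then show ?thesis unfolding tabloid_of_def standard_tabloid_def using r0 r1 by simp
qed

text \<open>Only the first column has two entries.\<close>

lemma col_stabilizer_hook:
  assumes n: "n \<ge> 2" and t: "t \<in> tableaux [n - 1, 1]"
  shows "col_stabilizer [n - 1, 1] t = {id, Transposition.transpose (t (0, 0)) (t (1, 0))}"
proof -
  let ?a = "t (0, 0)" and ?b = "t (1, 0)"
  have bij: "bij_betw t (cells [n - 1, 1]) {..<n}" using assms by (simp add: tableaux_def)
  have sum: "sum_list [n - 1, 1] = n" using n by simp
  have ab: "?a < n" "?b < n" "?a \<noteq> ?b"
  proof -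
    have c: "(0, 0) \<in> cells [n - 1, 1]" "(1, 0) \<in> cells [n - 1, 1]" using n by (auto simp: cells_hook)
    show "?a < n" "?b < n" using bij_betw_apply[OF bij] c by auto
    show "?a \<noteq> ?b" using inj_onD[OF bij_betw_imp_inj_on[OF bij] _ c] by auto
  qed
  have col0: "col [n - 1, 1] t 0 = {?a, ?b}"
  proof -
    have "{(a, b) \<in> cells [n - 1, 1]. b = 0} = {(0, 0), (1, 0)}" using n by (auto simp: cells_hook)
    then show ?thesis by (simp add: col_def)
  qed
  have colj: "col [n - 1, 1] t j = (if j < n - 1 then {t (0, j)} else {})" if "j \<noteq> 0" for j
  proof -
    have "{(a, b) \<in> cells [n - 1, 1]. b = j} = (if j < n - 1 then {(0, j)} else {})"
      using that by (auto simp: cells_hook)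
    then show ?thesis by (simp add: col_def)
  qed
  show ?thesis
  proof (intro equalityI subsetI)
    fix p assume "p \<in> col_stabilizer [n - 1, 1] t"
    then have p: "p permutes {..<n}" and st: "\<And>j. p ` col [n - 1, 1] t j = col [n - 1, 1] t j"
      unfolding col_stabilizer_def sum by auto
    have fix_other: "p x = x" if x: "x \<noteq> ?a" "x \<noteq> ?b" for x
    proof (cases "x < n")
      case True
      then have "x \<in> t ` cells [n - 1, 1]" using bij_betw_imp_surj_on[OF bij] by simp
      then obtain c where c: "c \<in> cells [n - 1, 1]" "x = t c" by blast
      with x have "c \<noteq> (0, 0)" "c \<noteq> (1, 0)" by auto
      with c obtain j where j: "c = (0, j)" "j < n - 1" "j \<noteq> 0" by (auto simp: cells_hook)
      then show ?thesis using st[of j] colj[of j] c by simp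
    next
      case False
      then show ?thesis using permutes_not_in[OF p] by simp
    qed
    have im: "{p ?a, p ?b} = {?a, ?b}" using st[of 0] unfolding col0 by simp
    show "p \<in> {id, Transposition.transpose ?a ?b}"
    proof (cases "p ?a = ?a")
      case True
      then have "p ?b = ?b" using im ab by (auto simp: doubleton_eq_iff)
      then have "p = id" using fix_other True by (metis eq_id_iff)
      then show ?thesis by simp
    next
      case False
      then have "p ?a = ?b" "p ?b = ?a" using im by (auto simp: doubleton_eq_iff)
      then have "p = Transposition.transpose ?a ?b"
        using fix_other by (auto simp: fun_eq_iff Transposition.transpose_def)
      then show ?thesis by simp
    qed
  next
    fix p assume p: "p \<in> {id, Transposition.transpose ?a ?b}"
    have "p permutes {..<n}" using p ab permutes_id permutes_swap_id[of ?a "{..<n}" ?b] by auto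
    moreover have "p ` col [n - 1, 1] t j = col [n - 1, 1] t j" for j
    proof (cases "j = 0")
      case True
      have "p ` {?a, ?b} = {?b, ?a} \<or> p ` {?a, ?b} = {?a, ?b}"
        using p by (elim insertE emptyE) simp_all
      then show ?thesis unfolding True col0 by (metis insert_commute)
    next
      case False
      show ?thesis
      proof (cases "j < n - 1")
        case True
        then have c: "(0, j) \<in> cells [n - 1, 1]" "(0, 0) \<in> cells [n - 1, 1]" "(1, 0) \<in> cells [n - 1, 1]"
          using n by (auto simp: cells_hook)
        have "t (0, j) \<noteq> ?a" "t (0, j) \<noteq> ?b"
          using inj_onD[OF bij_betw_imp_inj_on[OF bij] _ c(1,2)]
            inj_onD[OF bij_betw_imp_inj_on[OF bij] _ c(1,3)] \<open>j \<noteq> 0\<close> by auto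
        then have "p (t (0, j)) = t (0, j)" using p by (elim insertE emptyE) simp_all
        then show ?thesis unfolding colj[OF \<open>j \<noteq> 0\<close>] by simp
      next
        case False
        then show ?thesis unfolding colj[OF \<open>j \<noteq> 0\<close>] by simp
      qed
    qed
    ultimately show "p \<in> col_stabilizer [n - 1, 1] t" unfolding col_stabilizer_def sum by simp
  qed
qed

definition tabloid_difference :: "nat \<Rightarrow> nat \<Rightarrow> nat \<Rightarrow> tabloid \<Rightarrow> complex"
  where "tabloid_difference n a b
    = (\<lambda>T. of_bool (T = standard_tabloid n b) - of_bool (T = standard_tabloid n a))"

lemma polytabloid_hook:
  assumes n: "n \<ge> 2" and t: "t \<in> tableaux [n - 1, 1]"
  shows "polytabloid [n - 1, 1] t = tabloid_difference n (t (0, 0)) (t (1, 0))"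
    and "t (0, 0) < n" and "t (1, 0) < n" and "t (0, 0) \<noteq> t (1, 0)"
proof -
  let ?a = "t (0, 0)" and ?b = "t (1, 0)"
  let ?s = "Transposition.transpose ?a ?b"
  have bij: "bij_betw t (cells [n - 1, 1]) {..<n}" using assms by (simp add: tableaux_def)
  have c: "(0, 0) \<in> cells [n - 1, 1]" "(1, 0) \<in> cells [n - 1, 1]" using n by (auto simp: cells_hook)
  show a: "?a < n" and b: "?b < n" using bij_betw_apply[OF bij] c by auto
  show ab: "?a \<noteq> ?b" using inj_onD[OF bij_betw_imp_inj_on[OF bij] _ c] by auto
  have "bij_betw ?s {..<n} {..<n}"
    using permutes_swap_id[of ?a "{..<n}" ?b] a b by (intro permutes_imp_bij) auto
  then have "?s \<circ> t \<in> tableaux [n - 1, 1]"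
    using bij_betw_trans[OF bij] n by (simp add: tableaux_def)
  from tabloid_of_hook[OF n this] have "tabloid_of [n - 1, 1] (?s \<circ> t) = standard_tabloid n ?a"
    by simp
  moreover have "id \<noteq> ?s" using ab by (metis id_apply transpose_apply_first)
  ultimately show "polytabloid [n - 1, 1] t = tabloid_difference n ?a ?b"
    unfolding polytabloid_def col_stabilizer_hook[OF n t] tabloid_difference_def
    using ab tabloid_of_hook[OF n t] by (auto simp: fun_eq_iff sign_swap_id)
qed

lemma exists_tableau:
  assumes "n \<ge> 2" "a < n" "b < n" "a \<noteq> b"
  shows "\<exists>t\<in>tableaux [n - 1, 1]. t (0, 0) = a \<and> t (1, 0) = b"
proof -
  let ?C = "{0::nat} \<times> {1..<n - 1}" and ?D = "{..<n} - {a, b}"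
  have "card ?C = card ?D" using assms by (simp add: card_Diff_subset card_cartesian_product)
  then obtain g where g: "bij_betw g ?C ?D" using finite_same_card_bij[of ?C ?D] by auto
  define t where "t = g((0, 0) := a, (1, 0) := b)"
  have "bij_betw t ?C ?D = bij_betw g ?C ?D" by (rule bij_betw_cong) (auto simp: t_def)
  moreover have "bij_betw t {(0, 0), (1, 0)} {a, b}" using assms by (auto simp: bij_betw_def t_def)
  ultimately have "bij_betw t (?C \<union> {(0, 0), (1, 0)}) (?D \<union> {a, b})"
    using g by (intro bij_betw_combine) auto
  moreover have "?C \<union> {(0, 0), (1, 0)} = cells [n - 1, 1]" using assms by (auto simp: cells_hook)
  moreover have "?D \<union> {a, b} = {..<n}" using assms by auto
  ultimately have "t \<in> tableaux [n - 1, 1]" using assms by (simp add: tableaux_def)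
  then show ?thesis using assms by (intro bexI[of _ t]) (auto simp: t_def)
qed

lemma subspace_zero_sum: "cfun.subspace (zero_sum X)"
  by (auto simp: cfun.subspace_def zero_sum_def cscale_apply sum.distrib sum_distrib_left[symmetric])

text \<open>The polytabloids are the differences of two basis vectors; those involving the basis vector of a
  fixed tabloid already span all functions with sum zero.\<close>

lemma specht_hook:
  assumes n: "n \<ge> 2"
  shows "specht [n - 1, 1] = zero_sum (standard_tabloid n ` {..<n})"
    (is "_ = zero_sum ?X")
proof
  show "specht [n - 1, 1] \<subseteq> zero_sum ?X"
    unfolding specht_def
  proof (rule cfun.span_minimal[OF _ subspace_zero_sum], rule image_subsetI)
    fix t assume t: "t \<in> tableaux [n - 1, 1]"
    show "polytabloid [n - 1, 1] t \<in> zero_sum ?X"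
      using polytabloid_hook(2,3)[OF n t]
      unfolding polytabloid_hook(1)[OF n t]
      by (auto simp: zero_sum_def tabloid_difference_def sum.reindex[OF inj_standard_tabloid]
          sum_subtractf standard_tabloid_eq_iff of_bool_def)
  qed
  show "zero_sum ?X \<subseteq> specht [n - 1, 1]"
  proof
    fix w assume w: "w \<in> zero_sum ?X"
    let ?e = "standard_tabloid n"
    have "w (?e 0) + (\<Sum>b\<in>{..<n} - {0}. w (?e b)) = 0"
      using w n by (simp add: zero_sum_def sum.reindex[OF inj_standard_tabloid] sum.remove[of _ 0])
    then have total: "(\<Sum>b\<in>{..<n} - {0}. w (?e b)) = - w (?e 0)"
      by (simp only: eq_neg_iff_add_eq_0 add.commute)
    have "w = (\<Sum>b\<in>{..<n} - {0}. cscale (w (?e b)) (tabloid_difference n 0 b))"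
    proof
      fix T
      have "(\<Sum>b\<in>{..<n} - {0}. cscale (w (?e b)) (tabloid_difference n 0 b)) T
          = (\<Sum>b\<in>{..<n} - {0}. w (?e b) * of_bool (T = ?e b))
            - (\<Sum>b\<in>{..<n} - {0}. w (?e b)) * of_bool (T = ?e 0)"
        by (simp only: sum_fun_apply cscale_apply tabloid_difference_def right_diff_distrib
            sum_subtractf sum_distrib_right)
      also have "\<dots> = w T"
      proof (cases "T \<in> ?X")
        case True
        then obtain c where c: "c < n" "T = ?e c" by auto
        have "(\<Sum>b\<in>{..<n} - {0}. w (?e b) * of_bool (T = ?e b))
            = (\<Sum>b\<in>{..<n} - {0}. if b = c then w T else 0)"
          using c by (intro sum.cong) (auto simp: standard_tabloid_eq_iff)
        then show ?thesis using c total by (auto simp: standard_tabloid_eq_iff)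
      next
        case False
        then have "T \<noteq> ?e b" if "b < n" for b using that by auto
        then show ?thesis using False w n by (simp add: zero_sum_def)
      qed
      finally show "w T = (\<Sum>b\<in>{..<n} - {0}. cscale (w (?e b)) (tabloid_difference n 0 b)) T" by simp
    qed
    moreover have "tabloid_difference n 0 b \<in> polytabloid [n - 1, 1] ` tableaux [n - 1, 1]"
      if "b \<in> {..<n} - {0}" for b
    proof -
      have "\<exists>t\<in>tableaux [n - 1, 1]. t (0, 0) = 0 \<and> t (1, 0) = b"
        by (rule exists_tableau) (use n that in auto)
      then obtain t where "t \<in> tableaux [n - 1, 1]" "t (0, 0) = 0" "t (1, 0) = b" by blast
      then show ?thesis using polytabloid_hook(1)[OF n, of t] by (intro image_eqI[of _ _ t]) auto
    qed
    ultimately show "w \<in> specht [n - 1, 1]"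
      unfolding specht_def by (metis (no_types, lifting) cfun.span_base cfun.span_scale cfun.span_sum)
  qed
qed


section \<open>The dimension of the quasi-partition algebra\<close>

lemma tabloid_act_inverse:
  assumes "p permutes S"
  shows "tabloid_act (inv p) (tabloid_act p T) = T" "tabloid_act p (tabloid_act (inv p) T) = T"
  using permutes_inverses[OF assms]
  by (simp_all add: tabloid_act_def image_image o_def map_idI)

lemma bij_tabloid_act: "p permutes S \<Longrightarrow> bij (tabloid_act p)"
  by (rule o_bij[of "tabloid_act (inv p)"]) (auto simp: tabloid_act_inverse fun_eq_iff)

lemma inv_tabloid_act: "p permutes S \<Longrightarrow> inv (tabloid_act p) = tabloid_act (inv p)"
  by (rule inv_unique_comp) (auto simp: tabloid_act_inverse fun_eq_iff)

lemma diag_act_word_act: "p permutes S \<Longrightarrow> diag_act p = word_act (tabloid_act p)"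
  by (simp add: fun_eq_iff diag_act_def word_act_def inv_tabloid_act)

lemma tabloid_act_standard:
  assumes "p permutes {..<n}"
  shows "tabloid_act p (standard_tabloid n b) = standard_tabloid n (p b)"
  using permutes_image[OF assms] permutes_inj[OF assms]
  by (simp add: tabloid_act_def standard_tabloid_def image_set_diff)

lemma tabloid_action:
  assumes "n > 0"
  shows "full_symmetric_action (standard_tabloid n ` {..<n}) (tabloid_act ` {p. p permutes {..<n}})"
proof
  let ?e = "standard_tabloid n"
  show "finite (?e ` {..<n})" "?e ` {..<n} \<noteq> {}" using assms by auto
  show "bij g" if "g \<in> tabloid_act ` {p. p permutes {..<n}}" for g
    using that bij_tabloid_act by auto
  show "g ` ?e ` {..<n} = ?e ` {..<n}" if g: "g \<in> tabloid_act ` {p. p permutes {..<n}}" for g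
  proof -
    obtain p where p: "p permutes {..<n}" "g = tabloid_act p" using g by auto
    have "g ` ?e ` {..<n} = ?e ` p ` {..<n}"
      unfolding p(2) image_image tabloid_act_standard[OF p(1)] ..
    then show ?thesis by (simp add: permutes_image[OF p(1)])
  qed
  fix h assume h: "bij_betw h (?e ` {..<n}) (?e ` {..<n})"
  have e: "bij_betw ?e {..<n} (?e ` {..<n})" using inj_standard_tabloid by (simp add: bij_betw_def)
  define q where "q = inv_into {..<n} ?e \<circ> (h \<circ> ?e)"
  have q: "bij_betw q {..<n} {..<n}"
    unfolding q_def by (intro bij_betw_trans[OF bij_betw_trans[OF e h]] bij_betw_inv_into e)
  let ?p = "\<lambda>x. if x < n then q x else x"
  have "bij_betw ?p {..<n} {..<n} = bij_betw q {..<n} {..<n}" by (rule bij_betw_cong) simp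
  then have p: "?p permutes {..<n}" using q by (intro bij_imp_permutes) auto
  have "tabloid_act ?p T = h T" if T: "T \<in> ?e ` {..<n}" for T
  proof -
    obtain b where b: "b < n" "T = ?e b" using T by auto
    have "h T \<in> ?e ` {..<n}" using bij_betw_apply[OF h T] .
    then have "?e (q b) = h T" unfolding q_def using b by (simp add: f_inv_into_f)
    then show ?thesis using tabloid_act_standard[OF p, of b] b by simp
  qed
  then show "\<exists>g\<in>tabloid_act ` {p. p permutes {..<n}}. \<forall>x\<in>?e ` {..<n}. g x = h x"
    using p by blast
qed

lemma card_nonsingular_equivalences:
  "card (equivalences L - singular_equivalences L) = card (singleton_free_partitions {..<L})"
proof (rule bij_betw_same_card, rule bij_betw_byWitness)
  let ?rel = "\<lambda>P. {(x, y). \<exists>b\<in>P. x \<in> b \<and> y \<in> b} :: (nat \<times> nat) set"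
  have nonsing: "(\<forall>b\<in>{..<L} // R. card b \<noteq> 1) \<longleftrightarrow> R \<notin> singular_equivalences L"
    if R: "R \<in> equivalences L" for R
  proof -
    have self: "i \<in> R `` {i}" if "i < L" for i using equivalencesD(2)[OF R that] by simp
    have "card (R `` {i}) = 1 \<longleftrightarrow> R `` {i} = {i}" if "i < L" for i
    proof
      assume "card (R `` {i}) = 1"
      then obtain x where "R `` {i} = {x}" by (rule card_1_singletonE)
      then show "R `` {i} = {i}" using self[OF that] by simp
    qed simp
    then show ?thesis using R by (auto simp: quotient_def singular_equivalences_def)
  qed
  have rel: "?rel P \<in> equivalences L" "{..<L} // ?rel P = P" if "partition_on {..<L} P" for P
    using equiv_partition_on[OF that] partition_on_eq_quotient[OF that] by (simp_all add: equivalences_def)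
  show "\<forall>R\<in>equivalences L - singular_equivalences L. ?rel ({..<L} // R) = R"
  proof
    fix R assume "R \<in> equivalences L - singular_equivalences L"
    then have R: "equiv {..<L} R" by (simp add: equivalences_def)
    have "(\<exists>b\<in>{..<L} // R. x \<in> b \<and> y \<in> b) \<longleftrightarrow> (x, y) \<in> R" for x y
    proof
      assume "\<exists>b\<in>{..<L} // R. x \<in> b \<and> y \<in> b"
      then show "(x, y) \<in> R" using in_quotient_imp_in_rel[OF R] by auto
    next
      assume xy: "(x, y) \<in> R"
      then have x: "x \<in> {..<L}" using equiv_type[OF R] by auto
      show "\<exists>b\<in>{..<L} // R. x \<in> b \<and> y \<in> b"
        using quotientI[OF x, of R] equiv_class_self[OF R x] xy by (intro bexI[of _ "R `` {x}"]) auto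
    qed
    then show "?rel ({..<L} // R) = R" by auto
  qed
  show "\<forall>P\<in>singleton_free_partitions {..<L}. {..<L} // ?rel P = P"
    using rel(2) by (simp add: singleton_free_partitions_def)
  show "(\<lambda>R. {..<L} // R) ` (equivalences L - singular_equivalences L) \<subseteq> singleton_free_partitions {..<L}"
    using nonsing partition_on_quotient by (auto simp: singleton_free_partitions_def equivalences_def)
  show "?rel ` singleton_free_partitions {..<L} \<subseteq> equivalences L - singular_equivalences L"
  proof (rule image_subsetI)
    fix P assume "P \<in> singleton_free_partitions {..<L}"
    then have P: "partition_on {..<L} P" "\<forall>b\<in>P. card b \<noteq> 1" by (auto simp: singleton_free_partitions_def)
    then show "?rel P \<in> equivalences L - singular_equivalences L"
      using nonsing[OF rel(1)[OF P(1)]] rel[OF P(1)] by simp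
  qed
qed

lemma dim_quasi_partition_algebra:
  assumes "2 * k \<le> n" "n \<ge> 2"
  shows "cmap.dim (quasi_partition_algebra k n) = card (singleton_free_partitions {..<2 * k})"
proof -
  let ?X = "standard_tabloid n ` {..<n}" and ?G = "tabloid_act ` {p. p permutes {..<n}}"
  interpret full_symmetric_action ?X ?G by (rule tabloid_action) (use assms in simp)
  have "quasi_partition_algebra k n = commutant k"
    unfolding quasi_partition_algebra_def Let_def commutant_def specht_hook[OF assms(2)]
    by (auto simp: diag_act_word_act)
  moreover have "card ?X = n" by (simp add: card_image inj_standard_tabloid)
  ultimately show ?thesis using dim_commutant assms(1) by (simp add: card_nonsingular_equivalences)
qed

theorem corollary2p6:
  fixes k n :: nat and A :: "'a set"
  assumes "k \<ge> 1" and "n \<ge> 2 * k + 1"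
    and "finite A" and "card A = 2 * k"
  shows "cmap.dim (quasi_partition_algebra k n)
           = card {P. partition_on A P \<and> (\<forall>b\<in>P. card b \<noteq> 1)}
       \<and> int (card {P. partition_on A P \<and> (\<forall>b\<in>P. card b \<noteq> 1)})
           = (\<Sum>j = 1..2 * k. (- 1) ^ (j - 1) * int (bell (2 * k - j))) + 1"
proof -
  obtain f where "bij_betw f A {..<2 * k}"
    using finite_same_card_bij[OF assms(3) finite_lessThan] assms(4) by auto
  then have "card {P. partition_on A P \<and> (\<forall>b\<in>P. card b \<noteq> 1)} = card (singleton_free_partitions {..<2 * k})"
    using card_singleton_free_partitions_cong by (simp add: singleton_free_partitions_def)
  moreover have "cmap.dim (quasi_partition_algebra k n) = card (singleton_free_partitions {..<2 * k})"
    using assms(1,2) by (intro dim_quasi_partition_algebra) auto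
  ultimately show ?thesis
    using card_singleton_free_partitions_bell[of "2 * k"] by simp
qed

end
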